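(* Let $n\ge2$ and let $p(x)=\sum_{j=0}^np_jT_j(x)$ with $p_n=1$, expressed in the basis of Chebyshev polynomials of the first kind. Let $C=H-\chi^{-1}e_1c^T$ be its scaled colleague linearization, where $\chi=2$, $c=[p_{n-1},\dots,p_1,\sqrt2\,p_0]^T$ and $H$ is the $n\times n$ scaled colleague matrix of the context. Consider perturbations with $\|\delta H\|_2\le\epsilon_H$, $\|\delta e_1\|_2\le\epsilon_1$, $\|\delta c\|_2\le\epsilon_c$. Then the matrix $C+\delta C:=H+\delta H-\chi^{-1}(e_1+\delta e_1)(c+\delta c)^T$ linearizes the polynomial $$p(x)+\delta p(x):=\sum_{j=0}^n(p_j+\delta p_j)T_j(x),$$ where, for every $j$, $$|\delta p_j|\le\left(6\|c\|_2\epsilon_1+2\sqrt n\,\epsilon_c+(5+16\sqrt n\,\|c\|_2)\epsilon_H\right)n^2+O(\epsilon_H^2+\epsilon_1^2+\epsilon_c^2).$$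
   Context: $T_0(x)=1$, $T_1(x)=x$, $T_{k+1}(x)=2xT_k(x)-T_{k-1}(x)$. $H$ is the $n\times n$ real symmetric tridiagonal matrix with zero diagonal, whose off-diagonal entries satisfy $H_{i,i+1}=H_{i+1,i}=\tfrac12$ for $1\le i\le n-2$ and $H_{n-1,n}=H_{n,n-1}=\tfrac{\sqrt2}2$. That $C+\delta C$ linearizes $p+\delta p$ means $p(x)+\delta p(x)=\nu_n\det(xI-C-\delta C)$, where $\nu_n=2^{n-1}$ is the leading coefficient of $T_n$. The $O(\cdot)$ term is for fixed $n$ and $p$, as $\epsilon_H,\epsilon_1,\epsilon_c\to0$, uniformly over all perturbations satisfying the norm bounds. *)

theory Defs
  imports
    "HOL-Analysis.L2_Norm"
    "Jordan_Normal_Form.Char_Poly"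
begin

fun cheb_T :: "nat \<Rightarrow> 'a::comm_ring_1 poly" where
  "cheb_T 0 = 1"
| "cheb_T (Suc 0) = [:0, 1:]"
| "cheb_T (Suc (Suc k)) = [:0, 2:] * cheb_T (Suc k) - cheb_T k"

definition vec_norm2 :: "complex vec \<Rightarrow> real" where
  "vec_norm2 v = L2_set (\<lambda>i. cmod (v $ i)) {..<dim_vec v}"

text \<open>The set below is bounded, and it is nonempty as soon as \<open>A\<close> has at least one column;
  only then is the supremum meaningful.\<close>

definition mat_norm2 :: "complex mat \<Rightarrow> real" where
  "mat_norm2 A = (SUP v \<in> {v \<in> carrier_vec (dim_col A). vec_norm2 v = 1}. vec_norm2 (A *\<^sub>v v))"

text \<open>Matrix and vector indices start at 0, so the exceptional entry \<open>sqrt 2 / 2\<close> sits at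
  positions \<open>(n - 2, n - 1)\<close> and \<open>(n - 1, n - 2)\<close>.\<close>

definition scaled_colleague_H :: "nat \<Rightarrow> complex mat" where
  "scaled_colleague_H n = mat n n (\<lambda>(i, j).
     if j = Suc i \<or> i = Suc j
     then (if max i j = n - 1 then complex_of_real (sqrt 2 / 2) else 1 / 2)
     else 0)"

text \<open>The vector \<open>[p (n - 1), ..., p 1, sqrt 2 * p 0]\<close>.\<close>

definition colleague_vec :: "nat \<Rightarrow> (nat \<Rightarrow> complex) \<Rightarrow> complex vec" where
  "colleague_vec n p = vec n (\<lambda>i.
     if i = n - 1 then complex_of_real (sqrt 2) * p 0 else p (n - 1 - i))"

text \<open>The product \<open>u v\<^sup>T\<close>: plain transpose, no conjugation.\<close>

definition outer_T :: "complex vec \<Rightarrow> complex vec \<Rightarrow> complex mat" where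
  "outer_T u v = mat (dim_vec u) (dim_vec v) (\<lambda>(i, j). u $ i * v $ j)"

text \<open>The matrix \<open>H - \<chi>\<^sup>-\<^sup>1 u v\<^sup>T\<close> with \<open>\<chi> = 2\<close>. The scaled colleague linearization \<open>C\<close> of \<open>p\<close> is
  \<open>colleague_form (scaled_colleague_H n) (unit_vec n 0) (colleague_vec n p)\<close>.\<close>

definition colleague_form :: "complex mat \<Rightarrow> complex vec \<Rightarrow> complex vec \<Rightarrow> complex mat" where
  "colleague_form H u v = H - (1 / 2) \<cdot>\<^sub>m outer_T u v"

definition cheb_poly :: "nat \<Rightarrow> (nat \<Rightarrow> complex) \<Rightarrow> complex poly" where
  "cheb_poly n a = (\<Sum>j\<le>n. Polynomial.smult (a j) (cheb_T j))"

text \<open>The factor \<open>2 ^ (n - 1)\<close> is the leading coefficient of \<open>cheb_T n\<close> for \<open>n \<ge> 1\<close>.\<close>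

definition linearizes :: "nat \<Rightarrow> complex mat \<Rightarrow> complex poly \<Rightarrow> bool" where
  "linearizes n M q \<longleftrightarrow> M \<in> carrier_mat n n \<and> q = Polynomial.smult (2 ^ (n - 1)) (char_poly M)"

end

theory Submission
  imports Defs
begin

text \<open>
  Put \<open>M = x I - C\<close>. The perturbed characteristic matrix is \<open>M + E\<close> with a constant matrix \<open>E\<close>, and
  by the Leibniz formula \<open>det (M + E) = det M + tr (adj M E) + O(\<bar>E\<bar>\<^sup>2)\<close> with constants depending only
  on \<open>M\<close>. The entries of \<open>2\<^bsup>n-1\<^esup> adj M\<close> can be written down explicitly: they are affine in \<open>c\<close>, and all
  polynomials involved are signed sums of at most two second-kind Chebyshev polynomials, up to factors
  of modulus at most 1. Since a second-kind polynomial has coefficients of modulus at most 2 in the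
  basis \<open>T\<^sub>0, ..., T\<^sub>n\<close>, every entry of \<open>2\<^bsup>n-1\<^esup> adj M\<close> has coefficients bounded by
  \<open>4 + 4 \<Sum>\<^sub>i \<bar>c\<^sub>i\<bar> \<le> 4 + 4 sqrt n \<parallel>c\<parallel>\<close>, and the stated constants follow by summing over the entries of \<open>E\<close>.
\<close>

section \<open>Polynomials with bounded Chebyshev coefficients\<close>

lemma cheb_T_rec: "cheb_T (Suc (Suc k)) = [:0, 2:] * cheb_T (Suc k) - cheb_T k"
  by simp

fun sin_cheb :: "nat \<Rightarrow> complex poly" where
  "sin_cheb 0 = 0"
| "sin_cheb (Suc 0) = 1"
| "sin_cheb (Suc (Suc k)) = [:0, 2:] * sin_cheb (Suc k) - sin_cheb k"

text \<open>For \<open>m > 0\<close> this is the second-kind polynomial \<open>U\<close> of index \<open>m - 1\<close>. With this shift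
  the extension to negative indices is odd in \<open>m\<close>, as \<open>sin (m t) / sin t\<close> is.\<close>

definition cheb_S :: "int \<Rightarrow> complex poly" where
  "cheb_S m = (if m \<ge> 0 then sin_cheb (nat m) else - sin_cheb (nat (- m)))"

section \<open>Recurrence and product formula for second-kind polynomials\<close>

lemma cheb_S_0 [simp]: "cheb_S 0 = 0" and cheb_S_1 [simp]: "cheb_S 1 = 1"
  by (simp_all add: cheb_S_def)

lemma cheb_S_minus [simp]: "cheb_S (- m) = - cheb_S m"
  by (auto simp: cheb_S_def)

lemma cheb_S_rec_nonneg:
  assumes "m \<ge> 0"
  shows "cheb_S (m + 2) = [:0, 2:] * cheb_S (m + 1) - cheb_S m"
proof -
  obtain k where m: "m = int k" using assms nonneg_int_cases by blast
  have "nat (int k + 2) = Suc (Suc k)" "nat (int k + 1) = Suc k" by auto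
  then show ?thesis by (simp add: cheb_S_def m)
qed

text \<open>Oddness in \<open>m\<close> carries the recurrence from nonnegative to negative indices;
  at 0 it says \<open>cheb_S (- 1) = - 1\<close>.\<close>

lemma cheb_S_rec: "cheb_S (m + 1) = [:0, 2:] * cheb_S m - cheb_S (m - 1)"
proof -
  consider "m \<ge> 1" | "m = 0" | "m \<le> -1" by linarith
  then show ?thesis
  proof cases
    case 1
    then show ?thesis using cheb_S_rec_nonneg[of "m - 1"] by (simp add: algebra_simps)
  next
    case 2
    then show ?thesis using cheb_S_minus[of 1] by simp
  next
    case 3
    then have "cheb_S (- m + 1) = [:0, 2:] * cheb_S (- m) - cheb_S (- m - 1)"
      using cheb_S_rec_nonneg[of "- m - 1"] by (simp add: algebra_simps)
    moreover have "- m + 1 = - (m - 1)" "- m - 1 = - (m + 1)" by simp_all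
    ultimately have "- cheb_S (m - 1) = - ([:0, 2:] * cheb_S m) + cheb_S (m + 1)"
      by (simp only: cheb_S_minus mult_minus_right diff_minus_eq_add)
    then have "[:0, 2:] * cheb_S m + - cheb_S (m - 1) = cheb_S (m + 1)"
      by (simp only: add_minus_cancel)
    then show ?thesis by (simp only: diff_conv_add_uminus)
  qed
qed

text \<open>With x = cos t this is 2 cos(bt) sin(at) = sin((a+b)t) + sin((a-b)t), divided by sin t.
  Both sides obey the same three-term recurrence in \<open>b\<close>, and integer indices avoid a
  case split on a < b.\<close>

lemma two_cheb_T_mult_cheb_S:
  "2 * (cheb_T b * cheb_S a) = cheb_S (a + int b) + cheb_S (a - int b)"
proof (induction b rule: cheb_T.induct)
  case 1
  then show ?case by simp
next
  case 2
  have "cheb_S (a + 1) + cheb_S (a - 1) = [:0, 2:] * cheb_S a"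
    using cheb_S_rec[of a] by simp
  also have "\<dots> = 2 * ([:0, 1:] * cheb_S a)"
    by (simp add: numeral_poly)
  finally show ?case by simp
next
  case (3 k)
  have e: "cheb_S (a + int (Suc (Suc k))) = [:0, 2:] * cheb_S (a + int (Suc k)) - cheb_S (a + int k)"
    "cheb_S (a - int (Suc (Suc k))) = [:0, 2:] * cheb_S (a - int (Suc k)) - cheb_S (a - int k)"
    using cheb_S_rec[of "a + int (Suc k)"] cheb_S_rec[of "a - int (Suc k)"]
    by (simp_all add: algebra_simps)
  have "2 * (cheb_T (Suc (Suc k)) * cheb_S a) =
      [:0, 2:] * (2 * (cheb_T (Suc k) * cheb_S a)) - 2 * (cheb_T k * cheb_S a)"
    unfolding cheb_T_rec by (simp only: left_diff_distrib right_diff_distrib mult_ac)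
  also have "\<dots> = cheb_S (a + int (Suc (Suc k))) + cheb_S (a - int (Suc (Suc k)))"
    unfolding 3 e by (simp only: distrib_left) (simp only: diff_conv_add_uminus minus_add_distrib add_ac)
  finally show ?case .
qed

text \<open>The case a = 1 of the product formula. Read as S_{k+1} = S_{k-1} + 2 T_k, it telescopes
  to the expansion of S in the polynomials T.\<close>

lemma two_cheb_T: "2 * cheb_T k = cheb_S (int k + 1) - cheb_S (int k - 1)"
  using two_cheb_T_mult_cheb_S[of k 1] cheb_S_minus[of "int k - 1"]
  by (simp add: add.commute)

text \<open>Asking only for some expansion with small coefficients makes uniqueness of the expansion,
  and hence coefficient functionals, unnecessary.\<close>

definition cheb_bounded :: "nat \<Rightarrow> real \<Rightarrow> complex poly \<Rightarrow> bool" where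
  "cheb_bounded n B q \<longleftrightarrow> (\<exists>a. q = cheb_poly n a \<and> (\<forall>j\<le>n. cmod (a j) \<le> B))"

lemma cheb_boundedI: "q = cheb_poly n a \<Longrightarrow> (\<And>j. j \<le> n \<Longrightarrow> cmod (a j) \<le> B) \<Longrightarrow> cheb_bounded n B q"
  unfolding cheb_bounded_def by blast

section \<open>Calculus of coefficient bounds\<close>

lemma cheb_poly_add: "cheb_poly n a + cheb_poly n b = cheb_poly n (\<lambda>j. a j + b j)"
  by (simp add: cheb_poly_def smult_add_left sum.distrib)

lemma smult_sum_right: "Polynomial.smult c (\<Sum>i\<in>A. f i) = (\<Sum>i\<in>A. Polynomial.smult c (f i))"
  by (induction A rule: infinite_finite_induct) (auto simp: smult_add_right)

lemma smult_cheb_poly: "Polynomial.smult c (cheb_poly n a) = cheb_poly n (\<lambda>j. c * a j)"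
  by (simp add: cheb_poly_def smult_sum_right)

lemma cheb_bounded_mono: "cheb_bounded n B q \<Longrightarrow> B \<le> B' \<Longrightarrow> cheb_bounded n B' q"
  unfolding cheb_bounded_def using order_trans by blast

lemma cheb_bounded_nonneg: "cheb_bounded n B q \<Longrightarrow> 0 \<le> B"
  unfolding cheb_bounded_def by (metis le_refl norm_ge_zero order_trans)

lemma cheb_bounded_0: "0 \<le> B \<Longrightarrow> cheb_bounded n B 0"
  by (rule cheb_boundedI[of _ _ "\<lambda>_. 0"]) (auto simp: cheb_poly_def)

lemma cheb_bounded_add:
  assumes "cheb_bounded n B q" "cheb_bounded n B' q'"
  shows "cheb_bounded n (B + B') (q + q')"
proof -
  obtain a b where "q = cheb_poly n a" "\<forall>j\<le>n. cmod (a j) \<le> B"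
    "q' = cheb_poly n b" "\<forall>j\<le>n. cmod (b j) \<le> B'"
    using assms unfolding cheb_bounded_def by blast
  then show ?thesis
    by (intro cheb_boundedI[of _ _ "\<lambda>j. a j + b j"])
      (auto simp: cheb_poly_add intro!: norm_triangle_mono)
qed

lemma cheb_bounded_smult:
  assumes "cheb_bounded n B q"
  shows "cheb_bounded n (cmod c * B) (Polynomial.smult c q)"
proof -
  obtain a where "q = cheb_poly n a" "\<forall>j\<le>n. cmod (a j) \<le> B"
    using assms unfolding cheb_bounded_def by blast
  then show ?thesis
    by (intro cheb_boundedI[of _ _ "\<lambda>j. c * a j"])
      (auto simp: smult_cheb_poly norm_mult intro!: mult_left_mono)
qed

lemma cheb_bounded_smult_le:
  assumes "cheb_bounded n B q" "cmod c \<le> b"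
  shows "cheb_bounded n (b * B) (Polynomial.smult c q)"
  by (rule cheb_bounded_mono[OF cheb_bounded_smult[OF assms(1)]])
    (use assms cheb_bounded_nonneg in \<open>auto intro: mult_right_mono\<close>)

lemma cheb_bounded_minus: "cheb_bounded n B q \<Longrightarrow> cheb_bounded n B (- q)"
  using cheb_bounded_smult[of n B q "-1"] by simp

lemma cheb_bounded_diff:
  "cheb_bounded n B q \<Longrightarrow> cheb_bounded n B' q' \<Longrightarrow> cheb_bounded n (B + B') (q - q')"
  using cheb_bounded_add[OF _ cheb_bounded_minus] by fastforce

lemma cheb_bounded_sum:
  assumes "finite A" "\<And>i. i \<in> A \<Longrightarrow> cheb_bounded n (B i) (q i)"
  shows "cheb_bounded n (sum B A) (sum q A)"
  using assms by (induction A rule: finite_induct) (auto simp: cheb_bounded_0 cheb_bounded_add)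

lemma cheb_bounded_cheb_T:
  assumes "k \<le> n"
  shows "cheb_bounded n 1 (cheb_T k)"
proof (rule cheb_boundedI)
  show "cheb_T k = cheb_poly n (\<lambda>j. of_bool (j = k))"
    using assms by (simp add: cheb_poly_def of_bool_def if_distrib[of "\<lambda>c. Polynomial.smult c _"] cong: if_cong)
qed simp

lemma cheb_bounded_cheb_S_nat:
  assumes "k \<le> Suc n"
  shows "cheb_bounded n 2 (cheb_S (int k))"
proof -
  \<comment> \<open>Coefficients of S_k = 2 T_{k-1} + 2 T_{k-3} + ..., where a final T_0 counts only
    once.\<close>
  define a where "a k j = (if j < k \<and> odd (k - j) then if j = 0 then 1 else 2 else 0 :: complex)"
    for k j :: nat
  have "cheb_S (int k) = cheb_poly n (a k)" using assms
  proof (induction k rule: cheb_T.induct)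
    case 1
    then show ?case by (simp add: cheb_poly_def a_def)
  next
    case 2
    have "a (Suc 0) = (\<lambda>j. of_bool (j = 0))" by (auto simp: a_def fun_eq_iff odd_pos)
    then show ?case
      by (simp add: cheb_poly_def of_bool_def if_distrib[of "\<lambda>c. Polynomial.smult c _"] cong: if_cong)
  next
    case (3 k)
    have S: "cheb_S (int (Suc (Suc k))) = cheb_S (int k) + 2 * cheb_T (Suc k)"
      using two_cheb_T[of "Suc k"] by (simp add: algebra_simps)
    have T: "2 * cheb_T (Suc k) = cheb_poly n (\<lambda>j. if j = Suc k then 2 else 0)"
      using 3 by (simp add: cheb_poly_def numeral_poly if_distrib[of "\<lambda>c. Polynomial.smult c _"] cong: if_cong)
    have "a (Suc (Suc k)) = (\<lambda>j. a k j + (if j = Suc k then 2 else 0))"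
      by (auto simp: a_def fun_eq_iff less_Suc_eq Suc_diff_le)
    then show ?case unfolding S T using 3 by (simp add: cheb_poly_add)
  qed
  then show ?thesis by (rule cheb_boundedI) (auto simp: a_def odd_pos)
qed

lemma cheb_bounded_cheb_S:
  assumes "\<bar>m\<bar> \<le> int n + 1"
  shows "cheb_bounded n 2 (cheb_S m)"
proof (cases "m \<ge> 0")
  case True
  then show ?thesis using cheb_bounded_cheb_S_nat[of "nat m" n] assms by auto
next
  case False
  then show ?thesis
    using cheb_bounded_cheb_S_nat[of "nat (- m)" n, THEN cheb_bounded_minus] assms by auto
qed

lemma cheb_bounded_x_mult_cheb_T:
  assumes "j \<le> n"
  shows "cheb_bounded (Suc n) 1 ([:0, 1:] * cheb_T j)"
proof (cases j)
  case 0
  then show ?thesis using cheb_bounded_cheb_T[of 1 "Suc n"] by simp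
next
  case (Suc i)
  have "[:0, 1:] * cheb_T j =
      Polynomial.smult (1/2) (cheb_T (Suc j)) + Polynomial.smult (1/2 :: complex) (cheb_T i)"
    unfolding Suc cheb_T_rec by (simp add: smult_diff_right)
  moreover have "cheb_bounded (Suc n) (1/2 * 1 + 1/2 * 1) \<dots>"
    using Suc assms by (intro cheb_bounded_add cheb_bounded_smult_le cheb_bounded_cheb_T) auto
  ultimately show ?thesis by simp
qed

text \<open>Splitting q = c + x r and expanding x T_j shows by induction that T_0, ..., T_n span.
  The bound is not explicit, which suffices for pure existence and for constants hidden in the
  O-term.\<close>

lemma cheb_bounded_degree:
  assumes "degree q \<le> n"
  shows "\<exists>B. cheb_bounded n B q"
  using assms
proof (induction n arbitrary: q)
  case 0
  then obtain c where "q = [:c:]" by (auto elim: degree_eq_zeroE)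
  then have "q = cheb_poly 0 (\<lambda>_. c)" by (simp add: cheb_poly_def)
  then show ?case by (intro exI cheb_boundedI) auto
next
  case (Suc n)
  obtain c r where q: "q = pCons c r" by (rule pCons_cases)
  then have "degree r \<le> n" using Suc.prems by (auto split: if_splits)
  then obtain a where r: "r = cheb_poly n a" using Suc.IH unfolding cheb_bounded_def by blast
  have "q = Polynomial.smult c (cheb_T 0) + (\<Sum>j\<le>n. Polynomial.smult (a j) ([:0, 1:] * cheb_T j))"
  proof -
    have "q = Polynomial.smult c 1 + [:0, 1:] * r" by (simp add: q)
    then show ?thesis
      by (simp only: r cheb_poly_def sum_distrib_left mult_smult_right cheb_T.simps(1))
  qed
  moreover have "cheb_bounded (Suc n) (cmod c * 1 + (\<Sum>j\<le>n. cmod (a j) * 1)) \<dots>"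
    by (intro cheb_bounded_add cheb_bounded_sum cheb_bounded_smult cheb_bounded_cheb_T
        cheb_bounded_x_mult_cheb_T) auto
  ultimately show ?case by metis
qed

section \<open>Second-order expansion of a determinant\<close>

text \<open>Applied to the set of rows in which an entry of the perturbation is picked, this
  separates the terms of order 0, 1 and at least 2.\<close>

lemma sum_Pow_split_card:
  fixes f :: "'a set \<Rightarrow> 'b::comm_monoid_add"
  assumes "finite A"
  shows "(\<Sum>S\<in>Pow A. f S) = f {} + (\<Sum>k\<in>A. f {k}) + (\<Sum>S | S \<subseteq> A \<and> 2 \<le> card S. f S)"
proof -
  have fin: "finite S" if "S \<subseteq> A" for S using assms that by (rule rev_finite_subset)
  have "S = {} \<or> S \<in> (\<lambda>k. {k}) ` A \<or> 2 \<le> card S" if "S \<subseteq> A" for S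
  proof -
    consider "card S = 0" | "card S = 1" | "2 \<le> card S" by linarith
    then show ?thesis using that fin[OF that] by cases (auto simp: card_1_singleton_iff)
  qed
  then have "Pow A = insert {} ((\<lambda>k. {k}) ` A \<union> {S. S \<subseteq> A \<and> 2 \<le> card S})"
    by auto
  moreover have "sum f \<dots> = f {} + (\<Sum>k\<in>A. f {k}) + (\<Sum>S | S \<subseteq> A \<and> 2 \<le> card S. f S)"
    using assms by (subst sum.insert; (subst sum.union_disjoint)?) (auto simp: sum.reindex add.assoc)
  ultimately show ?thesis by simp
qed

text \<open>Cofactors along row \<open>k\<close> do not involve row \<open>k\<close>, so the Laplace
  expansion can use those of \<open>M\<close>.\<close>

lemma det_replace_row:
  fixes M :: "'a::comm_ring_1 mat"
  assumes M: "M \<in> carrier_mat n n" and k: "k < n"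
  shows "det (mat n n (\<lambda>(i, j). if i = k then e j else M $$ (i, j))) = (\<Sum>l<n. e l * cofactor M k l)"
proof -
  let ?N = "mat n n (\<lambda>(i, j). if i = k then e j else M $$ (i, j))"
  have "cofactor ?N k l = cofactor M k l" if "l < n" for l
  proof -
    have "mat_delete ?N k l = mat_delete M k l"
      using M k that by (intro eq_matI) (auto simp: mat_delete_def)
    then show ?thesis by (simp add: cofactor_def)
  qed
  then show ?thesis
    using laplace_expansion_row[of ?N n k] k by simp
qed

lemma cheb_bounded_signof:
  assumes "cheb_bounded n B q"
  shows "cheb_bounded n B (signof \<pi> * q)"
  using assms by (auto simp: sign_def intro: cheb_bounded_minus)

lemma prod_const_poly: "(\<Prod>i\<in>A. [:f i:]) = [:\<Prod>i\<in>A. f i :: 'a::comm_ring_1:]"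
  by (induction A rule: infinite_finite_induct) auto

text \<open>In each Leibniz product let \<open>S\<close> be the set of rows that contribute an entry
  of \<open>E\<close>. The empty set gives \<open>det M\<close>. Singletons give, summed over all
  permutations, the determinant of \<open>M\<close> with one row replaced by that of
  \<open>E\<close>. Larger sets stay explicit.\<close>

lemma det_add_const_expansion:
  fixes M :: "complex poly mat" and E :: "nat \<Rightarrow> nat \<Rightarrow> complex"
  assumes M: "M \<in> carrier_mat n n"
  shows "det (mat n n (\<lambda>(i, j). M $$ (i, j) + [:E i j:])) =
    det M + (\<Sum>k<n. \<Sum>l<n. Polynomial.smult (E k l) (cofactor M k l)) +
    (\<Sum>\<pi> | \<pi> permutes {0..<n}. signof \<pi> * (\<Sum>S | S \<subseteq> {0..<n} \<and> 2 \<le> card S.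
       Polynomial.smult (\<Prod>i\<in>S. E i (\<pi> i)) (\<Prod>i\<in>{0..<n} - S. M $$ (i, \<pi> i))))"
proof -
  let ?P = "{\<pi>. \<pi> permutes {0..<n}}"
  define W where "W \<pi> S = Polynomial.smult (\<Prod>i\<in>S. E i (\<pi> i)) (\<Prod>i\<in>{0..<n} - S. M $$ (i, \<pi> i))"
    for \<pi> :: "nat \<Rightarrow> nat" and S
  define R where "R \<pi> = (\<Sum>S | S \<subseteq> {0..<n} \<and> 2 \<le> card S. W \<pi> S)" for \<pi>
  have prod: "(\<Prod>i = 0..<n. M $$ (i, \<pi> i) + [:E i (\<pi> i):]) = W \<pi> {} + (\<Sum>k<n. W \<pi> {k}) + R \<pi>"
    for \<pi>
  proof -
    have "(\<Prod>i = 0..<n. M $$ (i, \<pi> i) + [:E i (\<pi> i):]) = (\<Prod>i = 0..<n. [:E i (\<pi> i):] + M $$ (i, \<pi> i))"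
      by (simp add: add.commute)
    also have "\<dots> = (\<Sum>S\<in>Pow {0..<n}. W \<pi> S)"
      by (subst prod_add) (simp_all add: prod_const_poly W_def)
    finally show ?thesis
      by (simp add: sum_Pow_split_card R_def atLeast0LessThan)
  qed
  have row: "(\<Sum>\<pi>\<in>?P. signof \<pi> * W \<pi> {k}) = (\<Sum>l<n. Polynomial.smult (E k l) (cofactor M k l))"
    if k: "k < n" for k
  proof -
    let ?N = "mat n n (\<lambda>(i, j). if i = k then [:E k j:] else M $$ (i, j))"
    have "W \<pi> {k} = (\<Prod>i = 0..<n. ?N $$ (i, \<pi> i))" if "\<pi> permutes {0..<n}" for \<pi>
    proof -
      have "\<pi> i < n" if "i < n" for i using permutes_in_image[OF \<open>\<pi> permutes _\<close>, of i] that by simp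
      then have "(\<Prod>i = 0..<n. ?N $$ (i, \<pi> i)) = (\<Prod>i = 0..<n. if i = k then [:E k (\<pi> k):] else M $$ (i, \<pi> i))"
        by (intro prod.cong) auto
      also have "\<dots> = [:E k (\<pi> k):] * (\<Prod>i\<in>{0..<n} - {k}. M $$ (i, \<pi> i))"
        using k by (subst prod.remove[of _ k]) (auto intro!: prod.cong arg_cong2[where f = "(*)"])
      finally show ?thesis by (simp add: W_def)
    qed
    then have "(\<Sum>\<pi>\<in>?P. signof \<pi> * W \<pi> {k}) = det ?N"
      by (subst det_def'[of _ n]) (auto intro!: sum.cong)
    then show ?thesis using det_replace_row[OF M k, of "\<lambda>j. [:E k j:]"] by simp
  qed
  have "det (mat n n (\<lambda>(i, j). M $$ (i, j) + [:E i j:])) =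
      (\<Sum>\<pi>\<in>?P. signof \<pi> * (\<Prod>i = 0..<n. M $$ (i, \<pi> i) + [:E i (\<pi> i):]))"
    by (subst det_def'[of _ n]) (auto intro!: sum.cong prod.cong arg_cong2[where f = "(*)"] simp: permutes_in_image)
  also have "\<dots> = (\<Sum>\<pi>\<in>?P. signof \<pi> * W \<pi> {}) + (\<Sum>k<n. \<Sum>\<pi>\<in>?P. signof \<pi> * W \<pi> {k})
      + (\<Sum>\<pi>\<in>?P. signof \<pi> * R \<pi>)"
    unfolding prod by (subst sum.swap) (simp only: distrib_left sum.distrib sum_distrib_left)
  also have "(\<Sum>\<pi>\<in>?P. signof \<pi> * W \<pi> {}) = det M"
    by (simp add: det_def'[OF M] W_def)
  also have "(\<Sum>k<n. \<Sum>\<pi>\<in>?P. signof \<pi> * W \<pi> {k}) =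
      (\<Sum>k<n. \<Sum>l<n. Polynomial.smult (E k l) (cofactor M k l))"
    by (intro sum.cong row) auto
  finally show ?thesis unfolding R_def W_def .
qed

text \<open>Every remaining term has at least two factors from \<open>E\<close>, and the
  complementary product of entries of \<open>M\<close> has degree at most \<open>n\<close>. Hence
  \<open>K\<close> depends on \<open>M\<close> alone.\<close>

lemma det_add_const_remainder:
  fixes M :: "complex poly mat"
  assumes M: "M \<in> carrier_mat n n" and deg: "\<And>i j. i < n \<Longrightarrow> j < n \<Longrightarrow> degree (M $$ (i, j)) \<le> 1"
  obtains K where "\<And>E r. 0 \<le> r \<Longrightarrow> r \<le> 1 \<Longrightarrow> (\<And>i j. i < n \<Longrightarrow> j < n \<Longrightarrow> cmod (E i j) \<le> r) \<Longrightarrow>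
    cheb_bounded n (K * r\<^sup>2) (det (mat n n (\<lambda>(i, j). M $$ (i, j) + [:E i j:])) - det M -
      (\<Sum>k<n. \<Sum>l<n. Polynomial.smult (E k l) (cofactor M k l)))"
proof -
  let ?W = "\<lambda>\<pi> S. \<Prod>i\<in>{0..<n} - S. M $$ (i, \<pi> i)"
  have "\<exists>B. cheb_bounded n B (?W \<pi> S)" if \<pi>: "\<pi> permutes {0..<n}" for \<pi> S
  proof (rule cheb_bounded_degree)
    have "degree (?W \<pi> S) \<le> (\<Sum>i\<in>{0..<n} - S. degree (M $$ (i, \<pi> i)))"
      using degree_prod_sum_le[of "{0..<n} - S"] by (simp add: o_def)
    also have "\<dots> \<le> (\<Sum>i\<in>{0..<n} - S. 1)"
      using permutes_in_image[OF \<pi>] by (intro sum_mono deg) auto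
    also have "\<dots> \<le> n" using card_mono[of "{0..<n}" "{0..<n} - S"] by simp
    finally show "degree (?W \<pi> S) \<le> n" .
  qed
  then obtain B where B: "\<And>\<pi> S. \<pi> permutes {0..<n} \<Longrightarrow> cheb_bounded n (B \<pi> S) (?W \<pi> S)"
    by metis
  define K where "K = (\<Sum>\<pi> | \<pi> permutes {0..<n}. \<Sum>S | S \<subseteq> {0..<n} \<and> 2 \<le> card S. B \<pi> S)"
  show thesis
  proof (rule that[of K])
    fix E :: "nat \<Rightarrow> nat \<Rightarrow> complex" and r :: real
    assume r: "0 \<le> r" "r \<le> 1" and E: "\<And>i j. i < n \<Longrightarrow> j < n \<Longrightarrow> cmod (E i j) \<le> r"
    have bd: "cmod (\<Prod>i\<in>S. E i (\<pi> i)) \<le> r\<^sup>2"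
      if "\<pi> permutes {0..<n}" "S \<subseteq> {0..<n}" "2 \<le> card S" for \<pi> S
    proof -
      have "cmod (\<Prod>i\<in>S. E i (\<pi> i)) \<le> (\<Prod>i\<in>S. r)"
        unfolding prod_norm[symmetric] using that permutes_in_image[OF that(1)]
        by (intro prod_mono) (auto intro!: E)
      \<comment> \<open>Since r \<le> 1, factors beyond the second only lower the bound.\<close>
      also have "\<dots> \<le> r\<^sup>2" using r that by (simp add: power_decreasing)
      finally show ?thesis .
    qed
    have "cheb_bounded n (\<Sum>\<pi> | \<pi> permutes {0..<n}. \<Sum>S | S \<subseteq> {0..<n} \<and> 2 \<le> card S. r\<^sup>2 * B \<pi> S)
      (\<Sum>\<pi> | \<pi> permutes {0..<n}. signof \<pi> * (\<Sum>S | S \<subseteq> {0..<n} \<and> 2 \<le> card S.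
        Polynomial.smult (\<Prod>i\<in>S. E i (\<pi> i)) (?W \<pi> S)))"
      using B bd finite_permutations[of "{0..<n}"]
      by (intro cheb_bounded_sum cheb_bounded_signof cheb_bounded_smult_le) auto
    then show "cheb_bounded n (K * r\<^sup>2) (det (mat n n (\<lambda>(i, j). M $$ (i, j) + [:E i j:])) - det M -
      (\<Sum>k<n. \<Sum>l<n. Polynomial.smult (E k l) (cofactor M k l)))"
      unfolding det_add_const_expansion[OF M] by (simp add: K_def sum_distrib_left mult.commute)
  qed
qed

section \<open>The resolvent of the colleague matrix\<close>

text \<open>Index n - 1 belongs to T_0, which is normalised by 1 / sqrt 2; this diagonal scaling is
  what makes H symmetric.\<close>

definition last_scale :: "nat \<Rightarrow> nat \<Rightarrow> complex" where
  "last_scale n k = (if k = n - 1 then complex_of_real (1 / sqrt 2) else 1)"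

definition offdiag :: "nat \<Rightarrow> nat \<Rightarrow> complex" where
  "offdiag n k = (if Suc k = n - 1 then complex_of_real (sqrt 2 / 2) else 1 / 2)"

definition colleague_matrix :: "nat \<Rightarrow> (nat \<Rightarrow> complex) \<Rightarrow> complex mat" where
  "colleague_matrix n c = colleague_form (scaled_colleague_H n) (unit_vec n 0) (vec n c)"

text \<open>Let \<open>M = x I - C\<close>. The vector \<open>t\<close> comes from solving \<open>M t = r e\<^sub>0\<close> from the last row upwards,
  which gives \<open>M t = (p / 2) e\<^sub>0\<close>. The vector \<open>y\<close> comes from solving
  \<open>M y = e\<^sub>k + r e\<^sub>0\<close> from row \<open>k\<close> upwards, with all entries from index \<open>k\<close> on equal to 0.
  Eliminating \<open>e\<^sub>0\<close> between the two yields column \<open>k\<close> of \<open>p M\<^sup>-\<^sup>1\<close>, which is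
  \<open>resolvent_numerator n c k\<close>; note that its column index comes first.\<close>

definition resolvent_t :: "nat \<Rightarrow> nat \<Rightarrow> complex poly" where
  "resolvent_t n i = Polynomial.smult (last_scale n i) (cheb_T (n - 1 - i))"

definition resolvent_y :: "nat \<Rightarrow> nat \<Rightarrow> nat \<Rightarrow> complex poly" where
  "resolvent_y n k i =
    (if i < k then Polynomial.smult (- 2 * last_scale n k) (cheb_S (int k - int i)) else 0)"

text \<open>This is p in terms of the entries of c: for \<open>colleague_vec n p\<close> the factor
  1 / sqrt 2 in the last \<open>resolvent_t\<close> cancels the sqrt 2 in the last entry.\<close>

definition colleague_poly :: "nat \<Rightarrow> (nat \<Rightarrow> complex) \<Rightarrow> complex poly" where
  "colleague_poly n c = cheb_T n + (\<Sum>i<n. Polynomial.smult (c i) (resolvent_t n i))"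

definition resolvent_numerator :: "nat \<Rightarrow> (nat \<Rightarrow> complex) \<Rightarrow> nat \<Rightarrow> nat \<Rightarrow> complex poly" where
  "resolvent_numerator n c k l = colleague_poly n c * resolvent_y n k l +
    (Polynomial.smult (2 * last_scale n k) (cheb_S (int k + 1)) -
      (\<Sum>i<n. Polynomial.smult (c i) (resolvent_y n k i))) * resolvent_t n l"

section \<open>Action of the characteristic matrix on t and y\<close>

lemma of_real_sqrt2_half: "complex_of_real (sqrt 2 / 2) = complex_of_real (1 / sqrt 2)"
  by (rule arg_cong[of _ _ complex_of_real]) (simp add: field_simps)

lemma offdiag_mult_last_scale: "offdiag n k * last_scale n (Suc k) = 1 / 2"
  by (auto simp: offdiag_def last_scale_def simp flip: of_real_mult)

lemma colleague_matrix_carrier [simp]: "colleague_matrix n c \<in> carrier_mat n n"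
  by (simp add: colleague_matrix_def colleague_form_def scaled_colleague_H_def outer_T_def
      carrier_matI)

lemma char_poly_matrix_index:
  assumes "A \<in> carrier_mat n n" "i < n" "j < n"
  shows "char_poly_matrix A $$ (i, j) = (if i = j then [:0, 1:] else 0) - [:A $$ (i, j):]"
  using assms by (auto simp: char_poly_matrix_def)

lemma colleague_matrix_index:
  assumes "i < n" "j < n"
  shows "colleague_matrix n c $$ (i, j) =
    (if 0 < i \<and> j = i - 1 then offdiag n (i - 1) else 0) + (if j = Suc i then offdiag n i else 0) -
    (if i = 0 then c j / 2 else 0)"
  using assms
  by (auto simp: colleague_matrix_def colleague_form_def scaled_colleague_H_def outer_T_def
      offdiag_def unit_vec_def max_def)

lemma char_poly_matrix_colleague_row:
  assumes i: "i < n"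
  shows "(\<Sum>j<n. char_poly_matrix (colleague_matrix n c) $$ (i, j) * v j) =
    [:0, 1:] * v i - (if 0 < i then Polynomial.smult (offdiag n (i - 1)) (v (i - 1)) else 0) -
    (if Suc i < n then Polynomial.smult (offdiag n i) (v (Suc i)) else 0) +
    (if i = 0 then Polynomial.smult (1/2) (\<Sum>j<n. Polynomial.smult (c j) (v j)) else 0)"
proof -
  \<comment> \<open>For i = 0 the truncated difference i - 1 is again 0, so the inner test 0 < i is
    what removes the left neighbour.\<close>
  have "char_poly_matrix (colleague_matrix n c) $$ (i, j) * v j =
      (if j = i then [:0, 1:] * v i else 0) -
      (if j = i - 1 then if 0 < i then Polynomial.smult (offdiag n (i - 1)) (v (i - 1)) else 0 else 0) -
      (if j = Suc i then Polynomial.smult (offdiag n i) (v (Suc i)) else 0) +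
      (if i = 0 then Polynomial.smult (1/2) (Polynomial.smult (c j) (v j)) else 0)"
    if "j < n" for j
    unfolding char_poly_matrix_index[OF colleague_matrix_carrier i that]
      colleague_matrix_index[OF i that]
    by (auto simp: smult_diff_left smult_add_left)
  then have "(\<Sum>j<n. char_poly_matrix (colleague_matrix n c) $$ (i, j) * v j) =
      (\<Sum>j<n. (if j = i then [:0, 1:] * v i else 0)) -
      (\<Sum>j<n. if j = i - 1 then if 0 < i then Polynomial.smult (offdiag n (i - 1)) (v (i - 1)) else 0 else 0) -
      (\<Sum>j<n. if j = Suc i then Polynomial.smult (offdiag n i) (v (Suc i)) else 0) +
      (\<Sum>j<n. if i = 0 then Polynomial.smult (1/2) (Polynomial.smult (c j) (v j)) else 0)"
    unfolding sum_subtractf[symmetric] sum.distrib[symmetric] by (intro sum.cong) auto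
  then show ?thesis
    using i by (auto simp: smult_sum_right)
qed

lemma x_mult_cheb_S:
  "[:0, 1:] * cheb_S m = Polynomial.smult (1/2) (cheb_S (m + 1)) + Polynomial.smult (1/2) (cheb_S (m - 1))"
  by (simp add: cheb_S_rec[of m] smult_diff_right)

lemma x_mult_cheb_T:
  "0 < k \<Longrightarrow> [:0, 1:] * cheb_T k =
    Polynomial.smult (1/2 :: complex) (cheb_T (Suc k)) + Polynomial.smult (1/2) (cheb_T (k - 1))"
  by (cases k) (simp_all add: smult_diff_right)

text \<open>Row i is the recurrence 2 x T_k = T_{k+1} + T_{k-1} at k = n - 1 - i, and the last row
  is x T_0 = T_1. In row 0 the missing T_n and the contribution of c together leave p / 2.\<close>

lemma char_poly_matrix_mult_t:
  assumes n: "2 \<le> n" and i: "i < n"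
  shows "(\<Sum>j<n. char_poly_matrix (colleague_matrix n c) $$ (i, j) * resolvent_t n j) =
    (if i = 0 then Polynomial.smult (1/2) (colleague_poly n c) else 0)"
proof -
  let ?h = "Polynomial.smult (1/2 :: complex)"
  have up: "Polynomial.smult (offdiag n i) (resolvent_t n (Suc i)) = ?h (cheb_T (n - 1 - Suc i))"
    by (simp only: resolvent_t_def smult_smult offdiag_mult_last_scale)
  \<comment> \<open>For i = n - 1 the exceptional entry sqrt 2 / 2 equals
    \<open>last_scale n i\<close>, so T_1 appears without the factor 1/2.\<close>
  have down: "Polynomial.smult (offdiag n (i - 1)) (resolvent_t n (i - 1)) =
      Polynomial.smult (last_scale n i) (if i = n - 1 then cheb_T 1 else ?h (cheb_T (n - i)))"
    if "0 < i"
  proof -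
    have "last_scale n (i - 1) = 1" "n - 1 - (i - 1) = n - i"
      using that i by (auto simp: last_scale_def)
    then show ?thesis
      using that i n of_real_sqrt2_half
      by (auto simp: resolvent_t_def offdiag_def last_scale_def)
  qed
  show ?thesis
  proof (cases "i = n - 1")
    case True
    then show ?thesis
      unfolding char_poly_matrix_colleague_row[OF i] up
      using n down by (simp add: resolvent_t_def)
  next
    case False
    then have "last_scale n i = 1" by (simp add: last_scale_def)
    moreover have "[:0, 1:] * cheb_T (n - 1 - i) = ?h (cheb_T (n - i)) + ?h (cheb_T (n - 1 - Suc i))"
      using False i x_mult_cheb_T[of "n - 1 - i"] by (simp add: Suc_diff_Suc)
    ultimately show ?thesis
      unfolding char_poly_matrix_colleague_row[OF i] up
      using False i down
      by (auto simp: resolvent_t_def colleague_poly_def smult_add_right simp del: mult_pCons_left)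
  qed
qed

text \<open>Rows strictly between 0 and k vanish by the recurrence for S, and row k sees only its
  left neighbour. Row 0 collects the missing S_{k+1} and the contribution of c.\<close>

lemma char_poly_matrix_mult_y:
  assumes n: "2 \<le> n" and i: "i < n" and k: "k < n"
  shows "(\<Sum>j<n. char_poly_matrix (colleague_matrix n c) $$ (i, j) * resolvent_y n k j) =
    (if i = k then 1 else 0) +
    (if i = 0 then Polynomial.smult (1/2) (\<Sum>j<n. Polynomial.smult (c j) (resolvent_y n k j)) -
      Polynomial.smult (last_scale n k) (cheb_S (int k + 1)) else 0)"
proof -
  have up: "Polynomial.smult (offdiag n i) (resolvent_y n k (Suc i)) =
      Polynomial.smult (- last_scale n k) (cheb_S (int k - int i - 1))" if "i < k"
  proof (cases "Suc i = k")
    case True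
    then show ?thesis by (auto simp: resolvent_y_def)
  next
    case False
    then have "Suc i < k" "Suc i \<noteq> n - 1" using that k by auto
    then show ?thesis by (simp add: resolvent_y_def offdiag_def algebra_simps)
  qed
  have down: "Polynomial.smult (offdiag n (i - 1)) (resolvent_y n k (i - 1)) =
      Polynomial.smult (- last_scale n k) (cheb_S (int k - int i + 1))" if "0 < i" "i < k"
    using that k by (auto simp: resolvent_y_def offdiag_def of_nat_diff algebra_simps)
  \<comment> \<open>The factor \<open>- 2 * last_scale n k\<close> in \<open>resolvent_y\<close> is
    chosen so that row \<open>k\<close> gives exactly 1.\<close>
  have down': "Polynomial.smult (offdiag n (i - 1)) (resolvent_y n k (i - 1)) = - 1" if "0 < i" "i = k"
  proof -
    have "offdiag n (k - 1) * last_scale n k = 1 / 2"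
      using offdiag_mult_last_scale[of n "k - 1"] that by simp
    then have "offdiag n (k - 1) * (- 2 * last_scale n k) = - 1" by (simp add: algebra_simps)
    moreover have "resolvent_y n k (k - 1) = Polynomial.smult (- 2 * last_scale n k) 1"
      using that by (simp add: resolvent_y_def of_nat_diff)
    ultimately show ?thesis using that by (simp only: smult_smult smult_minus_left smult_1_left)
  qed
  consider "i < k" "0 < i" | "i < k" "i = 0" | "i = k" "0 < i" | "i = k" "i = 0" | "k < i" by linarith
  then show ?thesis
  proof cases
    case 1
    have "[:0, 1:] * resolvent_y n k i = Polynomial.smult (- last_scale n k) (cheb_S (int k - int i + 1))
       + Polynomial.smult (- last_scale n k) (cheb_S (int k - int i - 1))"
      using 1 by (simp only: resolvent_y_def if_True mult_smult_right x_mult_cheb_S smult_add_right smult_smult) simp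
    then show ?thesis
      unfolding char_poly_matrix_colleague_row[OF i] using 1 k up down by simp
  next
    case 2
    have "[:0, 1:] * resolvent_y n k i = Polynomial.smult (- last_scale n k) (cheb_S (int k - int i + 1))
       + Polynomial.smult (- last_scale n k) (cheb_S (int k - int i - 1))"
      using 2 by (simp only: resolvent_y_def if_True mult_smult_right x_mult_cheb_S smult_add_right smult_smult) simp
    then show ?thesis
      unfolding char_poly_matrix_colleague_row[OF i] using 2 k up by simp
  next
    case 3
    then show ?thesis
      unfolding char_poly_matrix_colleague_row[OF i] using down' by (simp add: resolvent_y_def)
  next
    \<comment> \<open>Here y is zero, and the 1 on the right cancels against
      \<open>cheb_S 1\<close>, because \<open>last_scale n 0 = 1\<close> for n \<ge> 2.\<close>
    case 4
    then show ?thesis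
      unfolding char_poly_matrix_colleague_row[OF i] using n by (simp add: resolvent_y_def last_scale_def one_pCons)
  next
    case 5
    then show ?thesis
      unfolding char_poly_matrix_colleague_row[OF i] by (auto simp: resolvent_y_def)
  qed
qed

section \<open>Characteristic polynomial and adjugate\<close>

text \<open>The numerator is p y + q t. If M y = e_k + r e_0, then q = - 2 r, so the e_0 components
  p r and q p / 2 cancel.\<close>

lemma char_poly_matrix_mult_numerator:
  assumes n: "2 \<le> n" and i: "i < n" and k: "k < n"
  shows "(\<Sum>l<n. char_poly_matrix (colleague_matrix n c) $$ (i, l) * resolvent_numerator n c k l) =
    (if i = k then colleague_poly n c else 0)"
proof -
  define q where "q = Polynomial.smult (2 * last_scale n k) (cheb_S (int k + 1)) -
      (\<Sum>i<n. Polynomial.smult (c i) (resolvent_y n k i))"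
  let ?M = "char_poly_matrix (colleague_matrix n c)"
  let ?p = "colleague_poly n c"
  have "(\<Sum>l<n. ?M $$ (i, l) * resolvent_numerator n c k l) =
      (\<Sum>l<n. ?p * (?M $$ (i, l) * resolvent_y n k l) + q * (?M $$ (i, l) * resolvent_t n l))"
    by (intro sum.cong refl) (simp only: resolvent_numerator_def q_def[symmetric] distrib_left mult_ac)
  also have "\<dots> = ?p * (\<Sum>l<n. ?M $$ (i, l) * resolvent_y n k l) + q * (\<Sum>l<n. ?M $$ (i, l) * resolvent_t n l)"
    by (simp only: sum.distrib sum_distrib_left)
  also have "\<dots> = (if i = k then ?p else 0)"
    unfolding char_poly_matrix_mult_y[OF n i k] char_poly_matrix_mult_t[OF n i]
    by (simp add: q_def algebra_simps smult_diff_right)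
  finally show ?thesis .
qed

text \<open>Cramer's rule for \<open>M t = (p / 2) e\<^sub>0\<close> in the last unknown: expanding along the replaced
  column leaves a triangular minor, whose diagonal consists of the off-diagonal entries of \<open>- H\<close>.\<close>

lemma char_poly_colleague_matrix:
  assumes n: "2 \<le> n"
  shows "Polynomial.smult (2 ^ (n - 1)) (char_poly (colleague_matrix n c)) = colleague_poly n c"
proof -
  let ?M = "char_poly_matrix (colleague_matrix n c)"
  let ?t = "vec n (resolvent_t n)"
  let ?R = "replace_col ?M (?M *\<^sub>v ?t) (n - 1)"
  let ?s = "complex_of_real (1 / sqrt 2)"
  obtain m where m: "n = Suc (Suc m)" using n by (metis Suc_le_D numeral_2_eq_2 Suc_le_mono)
  have M: "?M \<in> carrier_mat n n" by simp
  have Mt: "(?M *\<^sub>v ?t) $ i = (if i = 0 then Polynomial.smult (1/2) (colleague_poly n c) else 0)"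
    if "i < n" for i
    using char_poly_matrix_mult_t[OF n that, of c] that carrier_matD[OF M]
    by (simp add: scalar_prod_def atLeast0LessThan)
  have R: "?R \<in> carrier_mat n n" using carrier_matD[OF M] by (simp add: replace_col_def)
  have R_last: "?R $$ (i, n - 1) = (if i = 0 then Polynomial.smult (1/2) (colleague_poly n c) else 0)"
    if "i < n" for i
    using Mt[OF that] that n carrier_matD[OF M] by (simp add: replace_col_def)
  have minor: "mat_delete ?R 0 (n - 1) $$ (i, j) =
      (if Suc i = j then [:0, 1:] else 0) - [:colleague_matrix n c $$ (Suc i, j):]"
    if "i < n - 1" "j < n - 1" for i j
    using that carrier_matD[OF M] char_poly_matrix_index[OF colleague_matrix_carrier, of "Suc i" n j c]
    by (simp add: mat_delete_def replace_col_def)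
  have minor_carrier: "mat_delete ?R 0 (n - 1) \<in> carrier_mat (n - 1) (n - 1)"
    using R by (rule mat_delete_carrier)
  \<comment> \<open>Deleting row 0 removes the only row containing c and moves the subdiagonal of
    the tridiagonal matrix onto the diagonal.\<close>
  have ut: "upper_triangular (mat_delete ?R 0 (n - 1))"
  proof (rule upper_triangularI)
    fix i j assume "j < i" "i < dim_row (mat_delete ?R 0 (n - 1))"
    then show "mat_delete ?R 0 (n - 1) $$ (i, j) = 0"
      using carrier_matD[OF R] minor[of i j] by (simp add: colleague_matrix_index)
  qed
  have "det (mat_delete ?R 0 (n - 1)) = (\<Prod>i<n-1. mat_delete ?R 0 (n - 1) $$ (i, i))"
    unfolding det_upper_triangular[OF ut minor_carrier] prod_list_diag_prod
    using carrier_matD[OF R] by (simp add: atLeast0LessThan)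
  also have "\<dots> = (\<Prod>i<n-1. [:- offdiag n i:])"
  proof (intro prod.cong refl)
    fix i assume "i \<in> {..<n-1}"
    then show "mat_delete ?R 0 (n - 1) $$ (i, i) = [:- offdiag n i:]"
      using minor[of i i] by (simp add: colleague_matrix_index)
  qed
  also have "\<dots> = [:(\<Prod>i<n-1. - offdiag n i):]" by (rule prod_const_poly)
  \<comment> \<open>Only the last of the n - 1 factors is the exceptional entry; the other n - 2 are
    1/2 up to sign.\<close>
  also have "(\<Prod>i<n-1. - offdiag n i) = (-1) ^ (n - 1) * (?s * (1/2) ^ (n - 2))"
  proof -
    have "(\<Prod>i<m. - offdiag n i) = (\<Prod>i<m. - (1/2))"
      by (intro prod.cong) (auto simp: offdiag_def m)
    also have "\<dots> = (-1) ^ m * (1/2) ^ m"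
      by (simp flip: power_mult_distrib)
    finally have "(\<Prod>i<Suc m. - offdiag n i) = (-1) ^ m * (1/2) ^ m * - offdiag n m"
      by (simp only: prod.lessThan_Suc)
    also have "offdiag n m = ?s" by (simp add: offdiag_def m of_real_sqrt2_half del: of_real_divide)
    also have "(-1) ^ m * (1/2) ^ m * - ?s = (-1) ^ Suc m * (?s * (1/2) ^ m)"
      by (simp only: power_Suc mult_ac mult_minus_left mult_minus_right mult_1_left)
    finally show ?thesis by (simp only: m diff_Suc_1 diff_Suc_Suc numeral_2_eq_2 diff_zero)
  qed
  finally have minor_det: "det (mat_delete ?R 0 (n - 1)) = [:(-1) ^ (n - 1) * (?s * (1/2) ^ (n - 2)):]" .
  have half: "(1/2 :: complex) ^ (n - 1) = (1/2) ^ (n - 2) / 2"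
    by (simp add: m)
  have "det ?R = (\<Sum>i<n. ?R $$ (i, n - 1) * cofactor ?R i (n - 1))"
    using n by (intro laplace_expansion_column[OF R]) auto
  also have "\<dots> = (\<Sum>i<n. if i = 0 then Polynomial.smult (1/2) (colleague_poly n c) * cofactor ?R 0 (n - 1) else 0)"
    by (intro sum.cong) (auto simp: R_last simp del: One_nat_def)
  also have "\<dots> = Polynomial.smult (1/2) (colleague_poly n c) * cofactor ?R 0 (n - 1)"
    using n by simp
  \<comment> \<open>The sign of the cofactor cancels the sign of the minor.\<close>
  also have "cofactor ?R 0 (n - 1) = [:?s * (1/2) ^ (n - 2):]"
  proof -
    have "(-1 :: complex poly) ^ (n - 1) = (if even (n - 1) then 1 else - 1)"
      by (simp only: minus_one_power_iff)
    then show ?thesis unfolding cofactor_def minor_det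
      by (simp add: minus_one_power_iff del: One_nat_def)
  qed
  also have "det ?R = resolvent_t n (n - 1) * det ?M"
    using cramer_lemma_mat[OF M, of ?t "n - 1"] n by simp
  also have "resolvent_t n (n - 1) = [:?s:]" by (simp add: resolvent_t_def last_scale_def)
  finally have "Polynomial.smult ?s (char_poly (colleague_matrix n c)) =
      Polynomial.smult ?s (Polynomial.smult ((1/2) ^ (n - 1)) (colleague_poly n c))"
    by (simp add: char_poly_def half mult.commute del: of_real_divide One_nat_def)
  then have "char_poly (colleague_matrix n c) = Polynomial.smult ((1/2) ^ (n - 1)) (colleague_poly n c)"
    by (rule smult_cancel[rotated]) simp
  then show ?thesis by (simp add: power_one_over)
qed

text \<open>The numerators form a matrix G with M G = p I, and p is 2^(n-1) det M. Multiplying by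
  adj M from the left and cancelling det M, which is nonzero as a monic polynomial, identifies G
  with 2^(n-1) adj M.\<close>

lemma cofactor_char_poly_matrix_colleague:
  assumes n: "2 \<le> n" and k: "k < n" and l: "l < n"
  shows "Polynomial.smult (2 ^ (n - 1)) (cofactor (char_poly_matrix (colleague_matrix n c)) k l) =
    resolvent_numerator n c k l"
proof -
  let ?M = "char_poly_matrix (colleague_matrix n c)"
  let ?G = "mat n n (\<lambda>(l, k). resolvent_numerator n c k l)"
  let ?p = "colleague_poly n c"
  have M: "?M \<in> carrier_mat n n" and G: "?G \<in> carrier_mat n n" by simp_all
  note adj = adj_mat[OF M]
  have MG: "?M * ?G = ?p \<cdot>\<^sub>m 1\<^sub>m n"
  proof (rule eq_matI)
    fix i j assume "i < dim_row (?p \<cdot>\<^sub>m 1\<^sub>m n)" "j < dim_col (?p \<cdot>\<^sub>m 1\<^sub>m n)"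
    then show "(?M * ?G) $$ (i, j) = (?p \<cdot>\<^sub>m 1\<^sub>m n) $$ (i, j)"
      using char_poly_matrix_mult_numerator[OF n, of i j c] carrier_matD[OF M]
      by (simp add: scalar_prod_def atLeast0LessThan)
  qed (use carrier_matD[OF M] in auto)
  have "det ?M \<cdot>\<^sub>m ?G = (adj_mat ?M * ?M) * ?G"
    unfolding adj(3) using mult_smult_assoc_mat[OF one_carrier_mat G, of "det ?M"] G by simp
  also have "\<dots> = adj_mat ?M * (?M * ?G)" using adj(1) M G by (rule assoc_mult_mat)
  also have "\<dots> = ?p \<cdot>\<^sub>m adj_mat ?M" 
    unfolding MG using mult_smult_distrib[OF adj(1) one_carrier_mat, of ?p] adj(1) by simp
  finally have "(det ?M \<cdot>\<^sub>m ?G) $$ (l, k) = (?p \<cdot>\<^sub>m adj_mat ?M) $$ (l, k)" by simp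
  then have "det ?M * resolvent_numerator n c k l = ?p * cofactor ?M k l"
    using carrier_matD[OF M] k l by (simp add: adj_mat_def)
  also have "\<dots> = det ?M * Polynomial.smult (2 ^ (n - 1)) (cofactor ?M k l)"
    unfolding char_poly_colleague_matrix[OF n, of c, symmetric] by (simp add: char_poly_def)
  finally have "det ?M * resolvent_numerator n c k l = \<dots>" .
  moreover have "det ?M \<noteq> 0"
    using degree_monic_char_poly[OF colleague_matrix_carrier, of n c] unfolding char_poly_def by auto
  ultimately show ?thesis by (metis mult_left_cancel)
qed

section \<open>Coefficient bounds for the adjugate entries\<close>

lemma smult_cheb_S_mult_smult_cheb_T:
  "Polynomial.smult (2 * a) (cheb_S m) * Polynomial.smult b (cheb_T j) =
    Polynomial.smult (a * b) (cheb_S (m + int j) + cheb_S (m - int j))"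
  unfolding two_cheb_T_mult_cheb_S[symmetric] by (simp add: numeral_poly mult_ac)

lemma norm_last_scale_le: "cmod (last_scale n k) \<le> 1"
proof -
  have "1 / sqrt 2 \<le> (1::real)" by simp
  then show ?thesis by (simp add: last_scale_def norm_divide)
qed

lemma norm_last_scale_mult_le: "cmod (last_scale n k * last_scale n l) \<le> 1"
  using mult_mono[OF norm_last_scale_le[of n k] norm_last_scale_le[of n l]] by (simp add: norm_mult)

text \<open>The part of \<open>resolvent_numerator\<close> that is free of c;
  \<open>numerator_coeff\<close> below is the factor of the single entry \<open>c i\<close>.\<close>

definition numerator_const :: "nat \<Rightarrow> nat \<Rightarrow> nat \<Rightarrow> complex poly" where
  "numerator_const n k l = cheb_T n * resolvent_y n k l +
    Polynomial.smult (2 * last_scale n k) (cheb_S (int k + 1)) * resolvent_t n l"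

definition numerator_coeff :: "nat \<Rightarrow> nat \<Rightarrow> nat \<Rightarrow> nat \<Rightarrow> complex poly" where
  "numerator_coeff n k l i = resolvent_t n i * resolvent_y n k l - resolvent_y n k i * resolvent_t n l"

lemma resolvent_numerator_eq:
  "resolvent_numerator n c k l =
    numerator_const n k l + (\<Sum>i<n. Polynomial.smult (c i) (numerator_coeff n k l i))"
  by (simp add: resolvent_numerator_def numerator_const_def numerator_coeff_def colleague_poly_def
      algebra_simps sum_distrib_left sum_distrib_right sum_subtractf smult_diff_right)

text \<open>The terms quadratic in \<open>c\<close> cancel because \<open>numerator_coeff n k l i\<close> is antisymmetric in
  \<open>l\<close> and \<open>i\<close>. This is why \<open>\<epsilon>1\<close> is multiplied by the first power of the norm of \<open>c\<close> only.\<close>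

lemma sum_smult_resolvent_numerator:
  "(\<Sum>l<n. Polynomial.smult (c l) (resolvent_numerator n c k l)) =
    (\<Sum>l<n. Polynomial.smult (c l) (numerator_const n k l))"
proof -
  define T where "T = (\<Sum>l<n. Polynomial.smult (c l) (resolvent_t n l))"
  define Y where "Y = (\<Sum>l<n. Polynomial.smult (c l) (resolvent_y n k l))"
  have lin: "(\<Sum>l<n. Polynomial.smult (c l) (a * resolvent_y n k l + b * resolvent_t n l)) = a * Y + b * T"
    for a b
    by (simp add: T_def Y_def smult_add_right sum.distrib sum_distrib_left)
  show ?thesis
    unfolding resolvent_numerator_def numerator_const_def lin colleague_poly_def
      T_def[symmetric] Y_def[symmetric]
    by (simp add: algebra_simps)
qed

text \<open>Individual products below may have degree above \<open>n\<close>; their leading parts cancel after the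
  product formula for \<open>T\<close> and \<open>S\<close> has been applied.\<close>

lemma cheb_bounded_numerator_const:
  assumes k: "k < n" and l: "l < n"
  shows "cheb_bounded n 4 (numerator_const n k l)"
proof -
  have prod: "Polynomial.smult (2 * last_scale n k) (cheb_S (int k + 1)) * resolvent_t n l =
      Polynomial.smult (last_scale n k * last_scale n l)
        (cheb_S (int n + int k - int l) + cheb_S (int k + int l + 2 - int n))"
    using l unfolding resolvent_t_def smult_cheb_S_mult_smult_cheb_T
    by (simp add: of_nat_diff algebra_simps)
  consider "k \<le> l" | "l < k" by linarith
  then show ?thesis
  proof cases
    case 1
    have "cheb_bounded n (1 * (2 + 2)) (Polynomial.smult (last_scale n k * last_scale n l)
        (cheb_S (int n + int k - int l) + cheb_S (int k + int l + 2 - int n)))"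
      using 1 k l
      by (intro cheb_bounded_smult_le norm_last_scale_mult_le cheb_bounded_add cheb_bounded_cheb_S) auto
    then show ?thesis using 1 unfolding numerator_const_def prod by (simp add: resolvent_y_def)
  next
    case 2
    \<comment> \<open>Since both scalings now equal \<open>last_scale n k\<close>, the two copies of
      S with index n + k - l, which can exceed n + 1, cancel.\<close>
    then have l1: "last_scale n l = 1" using k by (simp add: last_scale_def)
    have "cheb_T n * resolvent_y n k l =
        Polynomial.smult (2 * - last_scale n k) (cheb_S (int k - int l)) * Polynomial.smult 1 (cheb_T n)"
      using 2 by (simp add: resolvent_y_def mult.commute)
    also have "\<dots> = - Polynomial.smult (last_scale n k)
        (cheb_S (int n + int k - int l) + cheb_S (int k - int l - int n))"
      unfolding smult_cheb_S_mult_smult_cheb_T by (simp add: algebra_simps)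
    finally have "numerator_const n k l = Polynomial.smult (last_scale n k)
        (cheb_S (int k + int l + 2 - int n) - cheb_S (int k - int l - int n))"
      unfolding numerator_const_def prod l1
      by (simp add: smult_add_right smult_diff_right)
    moreover have "cheb_bounded n (1 * (2 + 2)) \<dots>"
      using 2 k
      by (intro cheb_bounded_smult_le norm_last_scale_le cheb_bounded_diff cheb_bounded_cheb_S) auto
    ultimately show ?thesis by simp
  qed
qed

lemma resolvent_y_mult_resolvent_t:
  assumes l: "l < n" and "i < k"
  shows "resolvent_y n k i * resolvent_t n l = Polynomial.smult (- (last_scale n k * last_scale n l))
    (cheb_S (int k - int i + int n - 1 - int l) + cheb_S (int k - int i - int n + 1 + int l))"
proof -
  have "resolvent_y n k i * resolvent_t n l =
      Polynomial.smult (2 * - last_scale n k) (cheb_S (int k - int i)) * resolvent_t n l"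
    using assms by (simp add: resolvent_y_def)
  then show ?thesis
    using l unfolding resolvent_t_def smult_cheb_S_mult_smult_cheb_T
    by (simp add: of_nat_diff algebra_simps)
qed

text \<open>For k \<le> l the product formula yields only indices of modulus below n, so no
  cancellation is involved.\<close>

lemma cheb_bounded_resolvent_y_mult_resolvent_t:
  assumes "k < n" "i < k" "k \<le> l" "l < n"
  shows "cheb_bounded n 4 (resolvent_y n k i * resolvent_t n l)"
proof -
  have "cheb_bounded n (1 * (2 + 2)) (resolvent_y n k i * resolvent_t n l)"
    unfolding resolvent_y_mult_resolvent_t[OF assms(4,2)]
    using assms norm_last_scale_mult_le[of n k l]
    by (intro cheb_bounded_smult_le cheb_bounded_add cheb_bounded_cheb_S) auto
  then show ?thesis by simp
qed

text \<open>Both products are present only for i, l < k. They then share the term S with index k - i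
  - l + n - 1, which drops out of the difference.\<close>

lemma cheb_bounded_numerator_coeff:
  assumes k: "k < n" and l: "l < n" and i: "i < n"
  shows "cheb_bounded n 4 (numerator_coeff n k l i)"
proof -
  consider "k \<le> l" "k \<le> i" | "k \<le> l" "i < k" | "l < k" "k \<le> i" | "l < k" "i < k" by linarith
  then show ?thesis
  proof cases
    case 1
    then show ?thesis by (simp add: numerator_coeff_def resolvent_y_def cheb_bounded_0)
  next
    case 2
    then have "numerator_coeff n k l i = - (resolvent_y n k i * resolvent_t n l)"
      by (simp add: numerator_coeff_def resolvent_y_def)
    then show ?thesis
      using cheb_bounded_minus[OF cheb_bounded_resolvent_y_mult_resolvent_t[of k n i l]] 2 k l by simp
  next
    case 3
    then have "numerator_coeff n k l i = resolvent_y n k l * resolvent_t n i"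
      by (simp add: numerator_coeff_def resolvent_y_def mult.commute)
    then show ?thesis
      using cheb_bounded_resolvent_y_mult_resolvent_t[of k n l i] 3 k i by simp
  next
    case 4
    then have "last_scale n l = 1" "last_scale n i = 1" using k by (auto simp: last_scale_def)
    then have "numerator_coeff n k l i = Polynomial.smult (last_scale n k)
        (cheb_S (int k - int i - int n + 1 + int l) - cheb_S (int k - int l - int n + 1 + int i))"
      unfolding numerator_coeff_def mult.commute[of "resolvent_t n i"]
      using resolvent_y_mult_resolvent_t[OF i 4(1)] resolvent_y_mult_resolvent_t[OF l 4(2)]
      by (simp add: smult_add_right smult_diff_right algebra_simps)
    moreover have "cheb_bounded n (1 * (2 + 2)) \<dots>"
      using 4 k
      by (intro cheb_bounded_smult_le norm_last_scale_le cheb_bounded_diff cheb_bounded_cheb_S) auto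
    ultimately show ?thesis by simp
  qed
qed

lemma cheb_bounded_resolvent_numerator:
  assumes "k < n" "l < n"
  shows "cheb_bounded n (4 + 4 * (\<Sum>i<n. cmod (c i))) (resolvent_numerator n c k l)"
proof -
  have "cheb_bounded n (4 + (\<Sum>i<n. cmod (c i) * 4)) (resolvent_numerator n c k l)"
    unfolding resolvent_numerator_eq using assms
    by (intro cheb_bounded_add cheb_bounded_numerator_const cheb_bounded_sum cheb_bounded_smult
        cheb_bounded_numerator_coeff) auto
  then show ?thesis by (simp add: sum_distrib_left mult.commute)
qed

text \<open>For k = 0 the vector y vanishes and the numerator is 2 t, free of c. Hence the
  contribution of \<epsilon>c carries no norm of c.\<close>

lemma cheb_bounded_resolvent_numerator_0:
  assumes "2 \<le> n" "l < n"
  shows "cheb_bounded n 2 (resolvent_numerator n c 0 l)"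
proof -
  have "resolvent_numerator n c 0 l = Polynomial.smult (2 * last_scale n l) (cheb_T (n - 1 - l))"
    using assms by (simp add: resolvent_numerator_def resolvent_y_def resolvent_t_def)
      (simp add: last_scale_def)
  moreover have "cheb_bounded n (2 * 1) \<dots>"
    using norm_last_scale_le[of n l]
    by (intro cheb_bounded_smult_le cheb_bounded_cheb_T) (auto simp: norm_mult)
  ultimately show ?thesis by simp
qed

section \<open>Norm estimates\<close>

lemma vec_norm2_nonneg: "0 \<le> vec_norm2 v"
  by (simp add: vec_norm2_def)

lemma norm_vec_index_le: "i < dim_vec v \<Longrightarrow> cmod (v $ i) \<le> vec_norm2 v"
  unfolding vec_norm2_def by (rule member_le_L2_set) auto

text \<open>Cauchy-Schwarz against the all-ones vector.\<close>

lemma sum_norm_vec_le: "(\<Sum>i<dim_vec v. cmod (v $ i)) \<le> sqrt (real (dim_vec v)) * vec_norm2 v"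
  using L2_set_mult_ineq[of "\<lambda>_. 1" "\<lambda>i. cmod (v $ i)" "{..<dim_vec v}"]
  by (simp add: vec_norm2_def L2_set_constant)

lemma vec_norm2_unit_vec: "i < n \<Longrightarrow> vec_norm2 (unit_vec n i) = 1"
  by (simp add: vec_norm2_def L2_set_def unit_vec_def if_distrib[of cmod] if_distrib[of "\<lambda>x. x\<^sup>2"]
      cong: if_cong)

text \<open>The real supremum in \<open>mat_norm2\<close> bounds its members only once the set is
  known to be bounded; the sum of the moduli of all entries is a crude bound.\<close>

lemma bdd_above_mat_norm2:
  "bdd_above ((\<lambda>v. vec_norm2 (A *\<^sub>v v)) ` {v \<in> carrier_vec (dim_col A). vec_norm2 v = 1})"
proof (rule bdd_aboveI2)
  fix v :: "complex vec"
  assume v: "v \<in> {v \<in> carrier_vec (dim_col A). vec_norm2 v = 1}"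
  have "vec_norm2 (A *\<^sub>v v) \<le> (\<Sum>i<dim_row A. cmod ((A *\<^sub>v v) $ i))"
    using L2_set_le_sum[of "{..<dim_row A}" "\<lambda>i. cmod ((A *\<^sub>v v) $ i)"] by (simp add: vec_norm2_def)
  also have "\<dots> \<le> (\<Sum>i<dim_row A. \<Sum>j<dim_col A. cmod (A $$ (i, j)))"
  proof (rule sum_mono)
    fix i assume i: "i \<in> {..<dim_row A}"
    have "cmod ((A *\<^sub>v v) $ i) = cmod (\<Sum>j<dim_col A. A $$ (i, j) * v $ j)"
      using i v by (auto simp: scalar_prod_def atLeast0LessThan intro!: arg_cong[where f = cmod] sum.cong)
    also have "\<dots> \<le> (\<Sum>j<dim_col A. cmod (A $$ (i, j) * v $ j))" by (rule norm_sum)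
    also have "\<dots> \<le> (\<Sum>j<dim_col A. cmod (A $$ (i, j)))"
    proof (rule sum_mono)
      fix j assume "j \<in> {..<dim_col A}"
      then have "cmod (v $ j) \<le> 1" using norm_vec_index_le[of j v] v by auto
      then show "cmod (A $$ (i, j) * v $ j) \<le> cmod (A $$ (i, j))"
        by (simp add: norm_mult mult_left_le)
    qed
    finally show "cmod ((A *\<^sub>v v) $ i) \<le> (\<Sum>j<dim_col A. cmod (A $$ (i, j)))" .
  qed
  finally show "vec_norm2 (A *\<^sub>v v) \<le> (\<Sum>i<dim_row A. \<Sum>j<dim_col A. cmod (A $$ (i, j)))" .
qed

lemma norm_mat_index_le:
  assumes i: "i < dim_row A" and j: "j < dim_col A"
  shows "cmod (A $$ (i, j)) \<le> mat_norm2 A"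
proof -
  let ?e = "unit_vec (dim_col A) j"
  have "(A *\<^sub>v ?e) $ i = A $$ (i, j)" using i j by (simp add: scalar_prod_right_unit)
  then have "cmod (A $$ (i, j)) \<le> vec_norm2 (A *\<^sub>v ?e)"
    using norm_vec_index_le[of i "A *\<^sub>v ?e"] i by simp
  also have "\<dots> \<le> mat_norm2 A"
    unfolding mat_norm2_def by (rule cSUP_upper[OF _ bdd_above_mat_norm2]) (simp add: vec_norm2_unit_vec j)
  finally show ?thesis .
qed

section \<open>First-order term of the perturbed polynomial\<close>

lemma colleague_poly_colleague_vec:
  assumes "2 \<le> n" "p n = 1"
  shows "colleague_poly n (\<lambda>i. colleague_vec n p $ i) = cheb_poly n p"
proof -
  have "Polynomial.smult (colleague_vec n p $ i) (resolvent_t n i) =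
      Polynomial.smult (p (n - 1 - i)) (cheb_T (n - 1 - i))" if "i < n" for i
  proof -
    have "complex_of_real (sqrt 2) * complex_of_real (1 / sqrt 2) = 1"
      by (simp flip: of_real_mult)
    then show ?thesis using that
      by (auto simp: colleague_vec_def resolvent_t_def last_scale_def mult_ac)
  qed
  then have "colleague_poly n (\<lambda>i. colleague_vec n p $ i) =
      cheb_T n + (\<Sum>i<n. Polynomial.smult (p (n - 1 - i)) (cheb_T (n - 1 - i)))"
    by (simp add: colleague_poly_def)
  also have "(\<Sum>i<n. Polynomial.smult (p (n - 1 - i)) (cheb_T (n - 1 - i))) =
      (\<Sum>j<n. Polynomial.smult (p j) (cheb_T j))"
    using sum.nat_diff_reindex[of "\<lambda>j. Polynomial.smult (p j) (cheb_T j)" n] by simp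
  also have "cheb_T n + \<dots> = cheb_poly n p"
    using assms by (simp add: cheb_poly_def add.commute flip: lessThan_Suc_atMost)
  finally show ?thesis .
qed

text \<open>Here \<open>h\<close>, \<open>a\<close>, \<open>b\<close> are the entries of the three
  perturbations. \<open>h\<close> meets all numerators, \<open>b\<close> only those with k = 0, and
  \<open>a\<close> only the sums weighted by c, where the quadratic terms in c cancel. The products
  of \<open>a\<close> and \<open>b\<close> are of second order.\<close>

lemma cheb_bounded_first_order:
  fixes h :: "nat \<Rightarrow> nat \<Rightarrow> complex" and a b c :: "nat \<Rightarrow> complex"
  assumes n: "2 \<le> n"
    and h: "\<And>k l. k < n \<Longrightarrow> l < n \<Longrightarrow> cmod (h k l) \<le> \<epsilon>H"
    and a: "\<And>k. k < n \<Longrightarrow> cmod (a k) \<le> \<epsilon>1"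
    and b: "\<And>l. l < n \<Longrightarrow> cmod (b l) \<le> \<epsilon>c"
  defines "\<sigma> \<equiv> (\<Sum>i<n. cmod (c i))"
  shows "cheb_bounded n
    (real n * (real n * (\<epsilon>H * (4 + 4 * \<sigma>))) + real n * \<epsilon>c + real n * (2 * \<epsilon>1 * \<sigma>) +
      real n * (real n * (\<epsilon>1 * \<epsilon>c / 2 * (4 + 4 * \<sigma>))))
    (\<Sum>k<n. \<Sum>l<n. Polynomial.smult
      (- h k l + ((if k = 0 then b l else 0) + a k * c l + a k * b l) / 2)
      (resolvent_numerator n c k l))"
proof -
  let ?G = "resolvent_numerator n c"
  have "(\<Sum>k<n. \<Sum>l<n. Polynomial.smult
      (- h k l + ((if k = 0 then b l else 0) + a k * c l + a k * b l) / 2) (?G k l)) =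
    (\<Sum>k<n. \<Sum>l<n. Polynomial.smult (- h k l) (?G k l)) +
    (\<Sum>k<n. if k = 0 then \<Sum>l<n. Polynomial.smult (b l / 2) (?G 0 l) else 0) +
    (\<Sum>k<n. Polynomial.smult (a k / 2) (\<Sum>l<n. Polynomial.smult (c l) (?G k l))) +
    (\<Sum>k<n. \<Sum>l<n. Polynomial.smult (a k * b l / 2) (?G k l))"
    unfolding sum.distrib[symmetric] smult_sum_right
    by (intro sum.cong refl)
      (auto simp: sum.distrib[symmetric] smult_add_left smult_diff_left add_divide_distrib
        intro!: sum.cong)
  also have "(\<Sum>k<n. if k = 0 then \<Sum>l<n. Polynomial.smult (b l / 2) (?G 0 l) else 0) =
      (\<Sum>l<n. Polynomial.smult (b l / 2) (?G 0 l))"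
    using n by simp
  also have "(\<Sum>k<n. Polynomial.smult (a k / 2) (\<Sum>l<n. Polynomial.smult (c l) (?G k l))) =
      (\<Sum>k<n. Polynomial.smult (a k / 2) (\<Sum>l<n. Polynomial.smult (c l) (numerator_const n k l)))"
    unfolding sum_smult_resolvent_numerator ..
  finally have eq: "(\<Sum>k<n. \<Sum>l<n. Polynomial.smult
      (- h k l + ((if k = 0 then b l else 0) + a k * c l + a k * b l) / 2) (?G k l)) =
    (\<Sum>k<n. \<Sum>l<n. Polynomial.smult (- h k l) (?G k l)) +
    (\<Sum>l<n. Polynomial.smult (b l / 2) (?G 0 l)) +
    (\<Sum>k<n. Polynomial.smult (a k / 2) (\<Sum>l<n. Polynomial.smult (c l) (numerator_const n k l))) +
    (\<Sum>k<n. \<Sum>l<n. Polynomial.smult (a k * b l / 2) (?G k l))" .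
  have ab: "cmod (a k * b l / 2) \<le> \<epsilon>1 * \<epsilon>c / 2" if "k < n" "l < n" for k l
    using mult_mono'[OF a[OF that(1)] b[OF that(2)]] by (simp add: norm_mult norm_divide)
  have "cheb_bounded n
    ((\<Sum>k<n. \<Sum>l<n. \<epsilon>H * (4 + 4 * \<sigma>)) + (\<Sum>l<n. \<epsilon>c / 2 * 2) +
      (\<Sum>k<n. \<epsilon>1 / 2 * (\<Sum>l<n. cmod (c l) * 4)) +
      (\<Sum>k<n. \<Sum>l<n. \<epsilon>1 * \<epsilon>c / 2 * (4 + 4 * \<sigma>)))
    ((\<Sum>k<n. \<Sum>l<n. Polynomial.smult (- h k l) (?G k l)) +
    (\<Sum>l<n. Polynomial.smult (b l / 2) (?G 0 l)) +
    (\<Sum>k<n. Polynomial.smult (a k / 2) (\<Sum>l<n. Polynomial.smult (c l) (numerator_const n k l))) +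
    (\<Sum>k<n. \<Sum>l<n. Polynomial.smult (a k * b l / 2) (?G k l)))"
    unfolding \<sigma>_def
    using n h a b ab
    by (intro cheb_bounded_add cheb_bounded_sum cheb_bounded_smult_le cheb_bounded_smult
        cheb_bounded_numerator_const cheb_bounded_resolvent_numerator
        cheb_bounded_resolvent_numerator_0) (auto simp: norm_divide)
  then show ?thesis
    unfolding eq by (rule cheb_bounded_mono) (simp add: \<sigma>_def sum_distrib_left mult_ac)
qed

text \<open>The constant perturbation of x I - C is minus \<delta>H plus half the change of the
  rank-one term, with the product of \<delta>e and \<delta>c kept exactly.\<close>

lemma char_poly_matrix_colleague_form_perturbed:
  fixes c :: "complex vec"
  assumes c: "c \<in> carrier_vec n" and h: "\<delta>H \<in> carrier_mat n n"
    and a: "\<delta>e \<in> carrier_vec n" and b: "\<delta>c \<in> carrier_vec n"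
  defines "C \<equiv> colleague_form (scaled_colleague_H n + \<delta>H) (unit_vec n 0 + \<delta>e) (c + \<delta>c)"
  shows "C \<in> carrier_mat n n"
    and "char_poly_matrix C = mat n n (\<lambda>(k, l).
      char_poly_matrix (colleague_matrix n (\<lambda>i. c $ i)) $$ (k, l) +
      [:- \<delta>H $$ (k, l) + ((if k = 0 then \<delta>c $ l else 0) + \<delta>e $ k * c $ l + \<delta>e $ k * \<delta>c $ l) / 2:])"
proof -
  show C: "C \<in> carrier_mat n n"
    using assms by (auto simp: C_def colleague_form_def outer_T_def)
  have "C $$ (k, l) = colleague_matrix n (\<lambda>i. c $ i) $$ (k, l) - (- \<delta>H $$ (k, l) +
      ((if k = 0 then \<delta>c $ l else 0) + \<delta>e $ k * c $ l + \<delta>e $ k * \<delta>c $ l) / 2)"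
    if "k < n" "l < n" for k l
    using assms that
    by (auto simp: C_def colleague_matrix_def colleague_form_def outer_T_def scaled_colleague_H_def
        unit_vec_def algebra_simps add_divide_distrib)
  then show "char_poly_matrix C = mat n n (\<lambda>(k, l).
      char_poly_matrix (colleague_matrix n (\<lambda>i. c $ i)) $$ (k, l) +
      [:- \<delta>H $$ (k, l) + ((if k = 0 then \<delta>c $ l else 0) + \<delta>e $ k * c $ l + \<delta>e $ k * \<delta>c $ l) / 2:])"
    by (intro eq_matI) (auto simp: char_poly_matrix_index[OF C]
        char_poly_matrix_index[OF colleague_matrix_carrier] carrier_matD[OF char_poly_matrix_closed[OF C]])
qed

section \<open>Comparison of constants\<close>

lemma power2_sum3_le: "(x + y + z)\<^sup>2 \<le> 3 * (x\<^sup>2 + y\<^sup>2 + z\<^sup>2)" for x y z :: real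
  using sum_squares_bound[of x y] sum_squares_bound[of x z] sum_squares_bound[of y z]
  by (simp add: power2_eq_square algebra_simps)

text \<open>The squared quantity bounds the entries of the perturbation, so the determinant
  remainder fits into the O-term. The bound z \<le> 1 linearises the product y z.\<close>

lemma power2_perturbation_size_le:
  fixes x y z N :: real
  assumes "0 \<le> x" "0 \<le> y" "0 \<le> z" "z \<le> 1" "0 \<le> N"
  shows "(x + (z + y * N + y * z) / 2)\<^sup>2 \<le> 3 * (N + 1)\<^sup>2 * (x\<^sup>2 + y\<^sup>2 + z\<^sup>2)"
proof -
  have "x + (z + y * N + y * z) / 2 \<le> (N + 1) * (x + y + z)"
  proof -
    have "y * z \<le> y" "0 \<le> y * N" "0 \<le> N * x" "0 \<le> N * z"
      using assms by (auto simp: mult_left_le)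
    then have "x + (z + y * N + y * z) / 2 \<le> N * x + y * N + N * z + x + y + z"
      using assms by argo
    also have "\<dots> = (N + 1) * (x + y + z)" by (simp add: algebra_simps)
    finally show ?thesis .
  qed
  then have "(x + (z + y * N + y * z) / 2)\<^sup>2 \<le> ((N + 1) * (x + y + z))\<^sup>2"
    using assms by (intro power_mono) auto
  also have "\<dots> \<le> (N + 1)\<^sup>2 * (3 * (x\<^sup>2 + y\<^sup>2 + z\<^sup>2))"
    unfolding power_mult_distrib by (intro mult_left_mono power2_sum3_le) auto
  finally show ?thesis by (simp only: mult_ac)
qed

lemma first_order_constant_le:
  fixes n :: nat and x y z N \<sigma> :: real
  assumes n: "2 \<le> n" and "0 \<le> x" "0 \<le> y" "0 \<le> z" "0 \<le> N" and \<sigma>: "\<sigma> \<le> sqrt (real n) * N"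
  shows "real n * (real n * (x * (4 + 4 * \<sigma>))) + real n * z + real n * (2 * y * \<sigma>) \<le>
    (6 * N * y + 2 * sqrt (real n) * z + (5 + 16 * sqrt (real n) * N) * x) * (real n)\<^sup>2"
proof -
  have s: "1 \<le> sqrt (real n)" "sqrt (real n) \<le> real n"
    using n by (auto intro!: real_le_lsqrt simp: power2_eq_square)
  have "x * (4 + 4 * \<sigma>) \<le> (5 + 16 * sqrt (real n) * N) * x"
  proof -
    have "0 \<le> sqrt (real n) * N" using assms by simp
    then have "4 + 4 * \<sigma> \<le> 5 + 16 * sqrt (real n) * N" using \<sigma> by linarith
    then show ?thesis using assms(2) by (metis mult.commute mult_left_mono)
  qed
  then have "x * (4 + 4 * \<sigma>) * (real n)\<^sup>2 \<le> (5 + 16 * sqrt (real n) * N) * x * (real n)\<^sup>2"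
    by (intro mult_right_mono) auto
  then have 1: "real n * (real n * (x * (4 + 4 * \<sigma>))) \<le> (5 + 16 * sqrt (real n) * N) * x * (real n)\<^sup>2"
    by (simp only: power2_eq_square mult_ac)
  have "1 \<le> 2 * sqrt (real n)" "1 \<le> real n" using s by linarith+
  then have "1 * 1 \<le> (2 * sqrt (real n)) * real n" by (intro mult_mono) auto
  then have "1 * (z * real n) \<le> (2 * sqrt (real n) * real n) * (z * real n)"
    using assms by (intro mult_right_mono) auto
  then have 2: "real n * z \<le> 2 * sqrt (real n) * z * (real n)\<^sup>2"
    by (simp add: power2_eq_square mult_ac)
  \<comment> \<open>One factor sqrt n is absorbed into n^2, so the coefficient of y contains no sqrt
    n.\<close>
  have "\<sigma> \<le> real n * N" using \<sigma> mult_right_mono[OF s(2) assms(5)] by linarith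
  then have "real n * (2 * y * \<sigma>) \<le> real n * (2 * y * (real n * N))"
    using assms by (intro mult_left_mono) auto
  also have "\<dots> = 2 * (N * y * (real n)\<^sup>2)" by (simp add: power2_eq_square)
  also have "\<dots> \<le> 6 * (N * y * (real n)\<^sup>2)" using assms by (intro mult_right_mono) auto
  finally have 3: "real n * (2 * y * \<sigma>) \<le> 6 * N * y * (real n)\<^sup>2" by (simp add: mult_ac)
  show ?thesis using 1 2 3 by (simp add: algebra_simps)
qed

theorem corollary5p4:
  fixes n :: nat and p :: "nat \<Rightarrow> complex"
  assumes "n \<ge> 2" and "p n = 1"
  shows "\<exists>K \<eta> :: real. \<eta> > 0 \<and>
    (\<forall>\<epsilon>H \<epsilon>1 \<epsilon>c :: real.
     \<forall>\<delta>H \<in> carrier_mat n n. \<forall>\<delta>e \<in> carrier_vec n. \<forall>\<delta>c \<in> carrier_vec n.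
       mat_norm2 \<delta>H \<le> \<epsilon>H \<and> vec_norm2 \<delta>e \<le> \<epsilon>1 \<and> vec_norm2 \<delta>c \<le> \<epsilon>c \<longrightarrow>
       (\<exists>\<delta>p :: nat \<Rightarrow> complex.
          linearizes n
            (colleague_form (scaled_colleague_H n + \<delta>H) (unit_vec n 0 + \<delta>e) (colleague_vec n p + \<delta>c))
            (cheb_poly n (\<lambda>j. p j + \<delta>p j)) \<and>
          (\<epsilon>H < \<eta> \<and> \<epsilon>1 < \<eta> \<and> \<epsilon>c < \<eta> \<longrightarrow>
            (\<forall>j\<le>n. cmod (\<delta>p j) \<le>
               (6 * vec_norm2 (colleague_vec n p) * \<epsilon>1 + 2 * sqrt (real n) * \<epsilon>c
                 + (5 + 16 * sqrt (real n) * vec_norm2 (colleague_vec n p)) * \<epsilon>H) * (real n)\<^sup>2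
               + K * (\<epsilon>H\<^sup>2 + \<epsilon>1\<^sup>2 + \<epsilon>c\<^sup>2)))))"
proof -
  define c where "c i = colleague_vec n p $ i" for i
  define N where "N = vec_norm2 (colleague_vec n p)"
  define \<sigma> where "\<sigma> = (\<Sum>i<n. cmod (c i))"
  define \<nu> :: real where "\<nu> = 2 ^ (n - 1)"
  define g where "g = 4 + 4 * \<sigma>"
  let ?M = "char_poly_matrix (colleague_matrix n c)"
  have cv: "colleague_vec n p \<in> carrier_vec n" by (simp add: colleague_vec_def)
  have N: "0 \<le> N" by (simp add: N_def vec_norm2_nonneg)
  have cN: "cmod (c i) \<le> N" if "i < n" for i
    using norm_vec_index_le[of i "colleague_vec n p"] cv that by (simp add: c_def N_def)
  have \<sigma>: "\<sigma> \<le> sqrt (real n) * N" "0 \<le> \<sigma>"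
    using sum_norm_vec_le[of "colleague_vec n p"] cv by (auto simp: c_def N_def \<sigma>_def sum_nonneg)
  have p: "Polynomial.smult (2 ^ (n - 1)) (det ?M) = cheb_poly n p"
    using char_poly_colleague_matrix[OF assms(1), of c] colleague_poly_colleague_vec[of n p] assms
    by (simp add: char_poly_def c_def[abs_def])
  have deg: "degree (?M $$ (i, j)) \<le> 1" if "i < n" "j < n" for i j
    using that by (auto simp: char_poly_matrix_index[OF colleague_matrix_carrier] intro!: degree_diff_le)
  obtain K0 where K0: "\<And>E r. 0 \<le> r \<Longrightarrow> r \<le> 1 \<Longrightarrow>
      (\<And>i j. i < n \<Longrightarrow> j < n \<Longrightarrow> cmod (E i j) \<le> r) \<Longrightarrow>
      cheb_bounded n (K0 * r\<^sup>2) (det (mat n n (\<lambda>(i, j). ?M $$ (i, j) + [:E i j:])) - det ?M -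
        (\<Sum>k<n. \<Sum>l<n. Polynomial.smult (E k l) (cofactor ?M k l)))"
    by (rule det_add_const_remainder[of ?M n]) (use deg in auto)
  \<comment> \<open>The first summand pays for the product of \<delta>e and \<delta>c, the second
    for the determinant remainder.\<close>
  define K where "K = (real n)\<^sup>2 * g + \<nu> * \<bar>K0\<bar> * (3 * (N + 1)\<^sup>2)"
  \<comment> \<open>Chosen so that the entrywise bound \<open>r\<close> below is at most 1.\<close>
  define \<eta> where "\<eta> = 1 / (2 + N)"
  show ?thesis
  proof (rule exI[of _ K], rule exI[of _ \<eta>], intro conjI allI ballI impI)
    show "0 < \<eta>" using N by (simp add: \<eta>_def)
  next
    fix \<epsilon>H \<epsilon>1 \<epsilon>c :: real and \<delta>H :: "complex mat" and \<delta>e \<delta>c :: "complex vec"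
    assume carrier: "\<delta>H \<in> carrier_mat n n" "\<delta>e \<in> carrier_vec n" "\<delta>c \<in> carrier_vec n"
      and norms: "mat_norm2 \<delta>H \<le> \<epsilon>H \<and> vec_norm2 \<delta>e \<le> \<epsilon>1 \<and> vec_norm2 \<delta>c \<le> \<epsilon>c"
    let ?C = "colleague_form (scaled_colleague_H n + \<delta>H) (unit_vec n 0 + \<delta>e) (colleague_vec n p + \<delta>c)"
    let ?bound = "(6 * N * \<epsilon>1 + 2 * sqrt (real n) * \<epsilon>c + (5 + 16 * sqrt (real n) * N) * \<epsilon>H) * (real n)\<^sup>2
               + K * (\<epsilon>H\<^sup>2 + \<epsilon>1\<^sup>2 + \<epsilon>c\<^sup>2)"
    define E where "E k l = - \<delta>H $$ (k, l) +
      ((if k = 0 then \<delta>c $ l else 0) + \<delta>e $ k * c l + \<delta>e $ k * \<delta>c $ l) / 2" for k l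
    define D where "D = Polynomial.smult (2 ^ (n - 1)) (char_poly ?C) - cheb_poly n p"
    have C: "?C \<in> carrier_mat n n"
      by (rule char_poly_matrix_colleague_form_perturbed(1)[OF cv carrier])
    have H: "cmod (\<delta>H $$ (k, l)) \<le> \<epsilon>H" if "k < n" "l < n" for k l
      using norm_mat_index_le[of k \<delta>H l] that carrier norms by auto
    have e: "cmod (\<delta>e $ k) \<le> \<epsilon>1" if "k < n" for k
      using norm_vec_index_le[of k \<delta>e] that carrier norms by auto
    have c': "cmod (\<delta>c $ k) \<le> \<epsilon>c" if "k < n" for k
      using norm_vec_index_le[of k \<delta>c] that carrier norms by auto
    \<comment> \<open>Nonnegativity is forced, since the three numbers bound moduli of
      entries.\<close>
    have nonneg: "0 \<le> \<epsilon>H" "0 \<le> \<epsilon>1" "0 \<le> \<epsilon>c"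
      using H[of 0 0] e[of 0] c'[of 0] assms(1) by (auto intro: order_trans[OF norm_ge_zero])
    have D: "cheb_bounded n ?bound D" if small: "\<epsilon>H < \<eta>" "\<epsilon>1 < \<eta>" "\<epsilon>c < \<eta>"
    proof -
      define r where "r = \<epsilon>H + (\<epsilon>c + \<epsilon>1 * N + \<epsilon>1 * \<epsilon>c) / 2"
      define L where "L = (\<Sum>k<n. \<Sum>l<n. Polynomial.smult (E k l) (cofactor ?M k l))"
      define R where "R = det (mat n n (\<lambda>(i, j). ?M $$ (i, j) + [:E i j:])) - det ?M - L"
      have \<eta>: "\<eta> \<le> 1" "\<eta> * (2 + N) = 1" using N by (auto simp: \<eta>_def)
      have c1: "\<epsilon>c \<le> 1" using small \<eta> by linarith
      have r0: "0 \<le> r" using nonneg N by (simp add: r_def)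
      have r1: "r \<le> 1"
      proof -
        have "\<epsilon>1 * N \<le> \<eta> * N" using small N by (intro mult_right_mono) auto
        moreover have "\<epsilon>1 * \<epsilon>c \<le> \<epsilon>1" using nonneg c1 by (simp add: mult_left_le)
        moreover have "\<eta> * 2 + \<eta> * N = 1" using \<eta> by (simp add: algebra_simps)
        moreover have "0 \<le> \<eta> * N" using N small nonneg by simp
        ultimately show ?thesis using small unfolding r_def by argo
      qed
      have Er: "cmod (E k l) \<le> r" if "k < n" "l < n" for k l
      proof -
        have "cmod (\<delta>e $ k * c l) \<le> \<epsilon>1 * N" "cmod (\<delta>e $ k * \<delta>c $ l) \<le> \<epsilon>1 * \<epsilon>c"
          using that e c' cN nonneg N by (auto simp: norm_mult intro!: mult_mono)
        moreover have "cmod (if k = 0 then \<delta>c $ l else 0) \<le> \<epsilon>c" using c' that nonneg by simp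
        ultimately have "cmod ((if k = 0 then \<delta>c $ l else 0) + \<delta>e $ k * c l + \<delta>e $ k * \<delta>c $ l) \<le>
            \<epsilon>c + \<epsilon>1 * N + \<epsilon>1 * \<epsilon>c"
          by (intro norm_triangle_mono)
        then show ?thesis
          unfolding E_def r_def using H[OF that]
          by (intro norm_triangle_mono) (auto simp: norm_divide)
      qed
      have "char_poly ?C = det ?M + L + R"
        unfolding char_poly_def char_poly_matrix_colleague_form_perturbed(2)[OF cv carrier]
        by (simp add: R_def E_def c_def[abs_def])
      then have "D = Polynomial.smult (2 ^ (n - 1)) L + Polynomial.smult (2 ^ (n - 1)) R"
        unfolding D_def p[symmetric] by (simp add: smult_add_right)
      also have "Polynomial.smult (2 ^ (n - 1)) L =
          (\<Sum>k<n. \<Sum>l<n. Polynomial.smult (E k l) (resolvent_numerator n c k l))"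
        unfolding L_def smult_sum_right
        by (intro sum.cong refl)
          (simp add: cofactor_char_poly_matrix_colleague[OF assms(1), symmetric] mult.commute
            del: One_nat_def)
      finally have D_eq: "D = (\<Sum>k<n. \<Sum>l<n. Polynomial.smult (E k l) (resolvent_numerator n c k l)) +
          Polynomial.smult (2 ^ (n - 1)) R" .
      have "cheb_bounded n (real n * (real n * (\<epsilon>H * (4 + 4 * \<sigma>))) + real n * \<epsilon>c + real n * (2 * \<epsilon>1 * \<sigma>) +
          real n * (real n * (\<epsilon>1 * \<epsilon>c / 2 * (4 + 4 * \<sigma>))) + \<nu> * (K0 * r\<^sup>2)) D"
        unfolding D_eq E_def \<sigma>_def
        by (intro cheb_bounded_add cheb_bounded_first_order cheb_bounded_smult_le assms(1) H e c')
          (auto simp: \<nu>_def R_def L_def norm_power intro!: K0 r0 r1 Er)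
      then show ?thesis
      proof (rule cheb_bounded_mono)
        have "real n * (real n * (\<epsilon>1 * \<epsilon>c / 2 * (4 + 4 * \<sigma>))) = (real n)\<^sup>2 * g * (\<epsilon>1 * \<epsilon>c / 2)"
          by (simp add: power2_eq_square g_def)
        also have "\<dots> \<le> (real n)\<^sup>2 * g * (\<epsilon>H\<^sup>2 + \<epsilon>1\<^sup>2 + \<epsilon>c\<^sup>2)"
        proof (rule mult_left_mono)
          show "\<epsilon>1 * \<epsilon>c / 2 \<le> \<epsilon>H\<^sup>2 + \<epsilon>1\<^sup>2 + \<epsilon>c\<^sup>2"
            using sum_squares_bound[of \<epsilon>1 \<epsilon>c] nonneg zero_le_power2[of \<epsilon>H]
              mult_nonneg_nonneg[OF nonneg(2,3)] by linarith
          show "0 \<le> (real n)\<^sup>2 * g" using \<sigma> by (simp add: g_def)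
        qed
        finally have 1: "real n * (real n * (\<epsilon>1 * \<epsilon>c / 2 * (4 + 4 * \<sigma>))) \<le>
            (real n)\<^sup>2 * g * (\<epsilon>H\<^sup>2 + \<epsilon>1\<^sup>2 + \<epsilon>c\<^sup>2)" .
        have "K0 * r\<^sup>2 \<le> \<bar>K0\<bar> * (3 * (N + 1)\<^sup>2 * (\<epsilon>H\<^sup>2 + \<epsilon>1\<^sup>2 + \<epsilon>c\<^sup>2))"
          unfolding r_def using nonneg N c1 by (intro mult_mono power2_perturbation_size_le) auto
        then have "\<nu> * (K0 * r\<^sup>2) \<le> \<nu> * (\<bar>K0\<bar> * (3 * (N + 1)\<^sup>2 * (\<epsilon>H\<^sup>2 + \<epsilon>1\<^sup>2 + \<epsilon>c\<^sup>2)))"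
          by (intro mult_left_mono) (auto simp: \<nu>_def)
        then have 2: "\<nu> * (K0 * r\<^sup>2) \<le> \<nu> * \<bar>K0\<bar> * (3 * (N + 1)\<^sup>2) * (\<epsilon>H\<^sup>2 + \<epsilon>1\<^sup>2 + \<epsilon>c\<^sup>2)"
          by (simp only: mult_ac)
        have "K * (\<epsilon>H\<^sup>2 + \<epsilon>1\<^sup>2 + \<epsilon>c\<^sup>2) = (real n)\<^sup>2 * g * (\<epsilon>H\<^sup>2 + \<epsilon>1\<^sup>2 + \<epsilon>c\<^sup>2) +
            \<nu> * \<bar>K0\<bar> * (3 * (N + 1)\<^sup>2) * (\<epsilon>H\<^sup>2 + \<epsilon>1\<^sup>2 + \<epsilon>c\<^sup>2)"
          unfolding K_def by (rule distrib_right)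
        then show "real n * (real n * (\<epsilon>H * (4 + 4 * \<sigma>))) + real n * \<epsilon>c + real n * (2 * \<epsilon>1 * \<sigma>) +
          real n * (real n * (\<epsilon>1 * \<epsilon>c / 2 * (4 + 4 * \<sigma>))) + \<nu> * (K0 * r\<^sup>2) \<le> ?bound"
          using first_order_constant_le[OF assms(1) nonneg N \<sigma>(1)] 1 2 by linarith
      qed
    qed
    \<comment> \<open>The linearization is claimed for perturbations of every size, so an expansion
      of D must exist without smallness.\<close>
    have "degree D \<le> n"
    proof -
      have "degree (char_poly ?C) = n" "degree (char_poly (colleague_matrix n c)) = n"
        using degree_monic_char_poly C colleague_matrix_carrier by blast+
      then show ?thesis
        unfolding D_def p[symmetric] char_poly_def by (intro degree_diff_le) auto
    qed
    then have "\<exists>B. cheb_bounded n B D" by (rule cheb_bounded_degree)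
    \<comment> \<open>The expansion comes from the sharp bound if the perturbations are small, and
      from the degree bound otherwise.\<close>
    then obtain \<delta>p where \<delta>p: "D = cheb_poly n \<delta>p"
      "\<epsilon>H < \<eta> \<and> \<epsilon>1 < \<eta> \<and> \<epsilon>c < \<eta> \<longrightarrow> (\<forall>j\<le>n. cmod (\<delta>p j) \<le> ?bound)"
      using D unfolding cheb_bounded_def by metis
    show "\<exists>\<delta>p. linearizes n ?C (cheb_poly n (\<lambda>j. p j + \<delta>p j)) \<and>
      (\<epsilon>H < \<eta> \<and> \<epsilon>1 < \<eta> \<and> \<epsilon>c < \<eta> \<longrightarrow> (\<forall>j\<le>n. cmod (\<delta>p j) \<le>
        (6 * vec_norm2 (colleague_vec n p) * \<epsilon>1 + 2 * sqrt (real n) * \<epsilon>c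
          + (5 + 16 * sqrt (real n) * vec_norm2 (colleague_vec n p)) * \<epsilon>H) * (real n)\<^sup>2
          + K * (\<epsilon>H\<^sup>2 + \<epsilon>1\<^sup>2 + \<epsilon>c\<^sup>2)))"
    proof (intro exI conjI)
      show "linearizes n ?C (cheb_poly n (\<lambda>j. p j + \<delta>p j))"
        unfolding linearizes_def cheb_poly_add[symmetric] \<delta>p(1)[symmetric] D_def using C by simp
    qed (use \<delta>p(2) in \<open>simp add: N_def\<close>)
  qed
qed

end
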